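(* Let the data be jointly Gaussian: two independent samples of size $n$ from $y_A=x_A^\top\beta_A+u_A$ and $y_B=x_B^\top\beta_B+u_B$, with $x_k\sim\mathcal{N}(0,\Sigma_k)$ and $u_k\sim\mathcal{N}(0,\sigma_{u,k}^2)$ independent of $x_k$, $k\in\{A,B\}$. Index the distribution of the data by $\lambda=(\Sigma_A,\Sigma_B,\sigma_{u,A}^2,\sigma_{u,B}^2,\beta_A,\beta_B)$. For given $\Sigma_A,\Sigma_B,\sigma_{u,A}^2,\sigma_{u,B}^2,\beta_A$ and a given $\gamma_*\ne0$ in $\mathbb{R}^p$, consider the likelihood ratio test of nominal size $\alpha\in(0,1)$ of the simple hypothesis $$H_0:\ \lambda=(\Sigma_A,\Sigma_B,\sigma_{u,A}^2,\sigma_{u,B}^2,\beta_A,\beta_A)$$ against the simple alternative $$H_1:\ \lambda=(\Sigma_A,\Sigma_B,\sigma_{u,A}^2,\sigma_{u,B}^2,\beta_A,\beta_A+\gamma_* ).$$ Then, as $n\to\infty$, the power of this test (its rejection probability under $H_1$) equals $$\Phi\big(d_n-\Phi^{-1}(1-\alpha)\big)+o(1),\qquad d_n=\frac{\sqrt n\,\gamma_*^\top\Sigma_B\gamma_*}{\sqrt{(\gamma_*^\top\Sigma_B\gamma_* )^2/2+\gamma_*^\top\Sigma_B\gamma_*\,\sigma_{u,B}^2}}.$$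
   Context: Within each sample the $n$ observations $(x_{k,i},y_{k,i})$ are i.i.d., and the two samples are independent. $\beta_A,\beta_B\in\mathbb{R}^p$, $\Sigma_A,\Sigma_B$ are $p\times p$ covariance matrices. The likelihood ratio test of nominal size $\alpha$ rejects $H_0$ when the logarithm of the ratio of the likelihood under $H_1$ to that under $H_0$ exceeds $c_n(\alpha)$, where $c_n(\alpha)$ is chosen so that the rejection probability under $H_0$ equals $\alpha$. $\Phi$ is the standard normal cumulative distribution function. The dimension $p$ and all parameters may depend on $n$. *)

theory Defs
  imports "HOL-Probability.Probability"
begin

text \<open>
  Vectors of \<open>\<real>\<^sup>p\<close> are functions \<^typ>\<open>nat \<Rightarrow> real\<close> and \<open>p \<times> p\<close> matrices are functions
  \<^typ>\<open>nat \<Rightarrow> nat \<Rightarrow> real\<close>, of which only the values at indices below \<open>p\<close> matter: the dimension may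
  depend on the sample size.
\<close>

definition inner_p :: "nat \<Rightarrow> (nat \<Rightarrow> real) \<Rightarrow> (nat \<Rightarrow> real) \<Rightarrow> real" where
  "inner_p p a b = (\<Sum>j<p. a j * b j)"

definition quad_form :: "nat \<Rightarrow> (nat \<Rightarrow> nat \<Rightarrow> real) \<Rightarrow> (nat \<Rightarrow> real) \<Rightarrow> real" where
  "quad_form p S a = (\<Sum>i<p. \<Sum>j<p. a i * S i j * a j)"

definition covariance_matrix :: "nat \<Rightarrow> (nat \<Rightarrow> nat \<Rightarrow> real) \<Rightarrow> bool" where
  "covariance_matrix p S \<longleftrightarrow> (\<forall>i<p. \<forall>j<p. S i j = S j i) \<and> (\<forall>a. 0 \<le> quad_form p S a)"

text \<open>The law \<open>N(0, s2)\<close>, including the point mass at \<open>0\<close> for \<open>s2 = 0\<close>.\<close>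

definition centred_normal :: "real \<Rightarrow> real measure" where
  "centred_normal s2 = distr std_normal_distribution borel (\<lambda>z. sqrt s2 * z)"

definition vec_space :: "nat \<Rightarrow> (nat \<Rightarrow> real) measure" where
  "vec_space p = PiM {..<p} (\<lambda>_. borel)"

text \<open>
  The law \<open>N(0, S)\<close>, for a possibly singular \<open>S\<close>, is the law of \<open>L z\<close> with \<open>L L\<^sup>T = S\<close> and \<open>z\<close>
  standard normal in \<open>\<real>\<^sup>p\<close>. It does not depend on the choice of \<open>L\<close>, which exists whenever \<open>S\<close>
  is a covariance matrix; see \<open>matrix_root_exists\<close> and \<open>distr_mv_normal_inner_p\<close> below.
\<close>

definition is_matrix_root :: "nat \<Rightarrow> (nat \<Rightarrow> nat \<Rightarrow> real) \<Rightarrow> (nat \<Rightarrow> nat \<Rightarrow> real) \<Rightarrow> bool" where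
  "is_matrix_root p S L \<longleftrightarrow> (\<forall>i<p. \<forall>j<p. (\<Sum>k<p. L i k * L j k) = S i j)"

definition mv_normal :: "nat \<Rightarrow> (nat \<Rightarrow> nat \<Rightarrow> real) \<Rightarrow> (nat \<Rightarrow> real) measure" where
  "mv_normal p S =
     (let L = (SOME L. is_matrix_root p S L)
      in distr (PiM {..<p} (\<lambda>_. std_normal_distribution)) (vec_space p)
           (\<lambda>z. \<lambda>i\<in>{..<p}. \<Sum>k<p. L i k * z k))"

text \<open>The law of one observation \<open>(x, y)\<close> with \<open>y = x\<^sup>T b + u\<close>, \<open>x\<close> and \<open>u\<close> independent.\<close>

definition obs_law ::
    "nat \<Rightarrow> (nat \<Rightarrow> nat \<Rightarrow> real) \<Rightarrow> real \<Rightarrow> (nat \<Rightarrow> real) \<Rightarrow> ((nat \<Rightarrow> real) \<times> real) measure" where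
  "obs_law p S s2 b =
     distr (mv_normal p S \<Otimes>\<^sub>M centred_normal s2) (vec_space p \<Otimes>\<^sub>M borel)
       (\<lambda>(x, u). (x, inner_p p x b + u))"

type_synonym sample = "nat \<Rightarrow> (nat \<Rightarrow> real) \<times> real"

definition sample_law ::
    "nat \<Rightarrow> nat \<Rightarrow> (nat \<Rightarrow> nat \<Rightarrow> real) \<Rightarrow> real \<Rightarrow> (nat \<Rightarrow> real) \<Rightarrow> sample measure" where
  "sample_law n p S s2 b = PiM {..<n} (\<lambda>_. obs_law p S s2 b)"

definition data_law ::
    "nat \<Rightarrow> nat \<Rightarrow> (nat \<Rightarrow> nat \<Rightarrow> real) \<Rightarrow> (nat \<Rightarrow> nat \<Rightarrow> real) \<Rightarrow> real \<Rightarrow> real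
     \<Rightarrow> (nat \<Rightarrow> real) \<Rightarrow> (nat \<Rightarrow> real) \<Rightarrow> (sample \<times> sample) measure" where
  "data_law n p SA SB s2A s2B bA bB =
     sample_law n p SA s2A bA \<Otimes>\<^sub>M sample_law n p SB s2B bB"

text \<open>
  A likelihood is a density with respect to a dominating measure \<open>\<nu>\<close>. The latter is not taken to be
  Lebesgue measure, since the covariance matrices may be singular.
\<close>

definition is_likelihood :: "'a measure \<Rightarrow> 'a measure \<Rightarrow> ('a \<Rightarrow> real) \<Rightarrow> bool" where
  "is_likelihood \<nu> P l \<longleftrightarrow>
     l \<in> borel_measurable \<nu> \<and> (\<forall>z. 0 \<le> l z) \<and> P = density \<nu> (\<lambda>z. ennreal (l z))"

text \<open>The value at \<open>l1 = l0 = 0\<close> is immaterial: such points are null under both hypotheses.\<close>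

definition log_lik_ratio :: "real \<Rightarrow> real \<Rightarrow> ereal" where
  "log_lik_ratio l1 l0 =
     (if l1 = 0 then -\<infinity> else if l0 = 0 then \<infinity> else ereal (ln (l1 / l0)))"

definition lrt_rejection ::
    "'a measure \<Rightarrow> ('a \<Rightarrow> real) \<Rightarrow> ('a \<Rightarrow> real) \<Rightarrow> real \<Rightarrow> 'a set" where
  "lrt_rejection \<nu> l1 l0 c = {z \<in> space \<nu>. log_lik_ratio (l1 z) (l0 z) > ereal c}"

definition Phi :: "real \<Rightarrow> real" where
  "Phi = cdf std_normal_distribution"

definition Phi_inv :: "real \<Rightarrow> real" where
  "Phi_inv q = (THE z. Phi z = q)"

lemma quad_form_Suc:
  assumes "\<forall>i<Suc p. \<forall>j<Suc p. S i j = S j i"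
  shows "quad_form (Suc p) S a =
    quad_form p S a + 2 * a p * (\<Sum>i<p. a i * S i p) + (a p)\<^sup>2 * S p p"
proof -
  define w where "w = (\<Sum>i<p. a i * S i p)"
  have 1: "(\<Sum>j<p. a p * S p j * a j) = a p * w"
    unfolding w_def sum_distrib_left using assms by (intro sum.cong) (auto simp: algebra_simps)
  have 2: "(\<Sum>i<p. a i * S i p * a p) = a p * w"
    unfolding w_def sum_distrib_left by (intro sum.cong) (auto simp: algebra_simps)
  show ?thesis
    unfolding w_def[symmetric] quad_form_def
    by (simp add: sum.distrib 1 2 power2_eq_square)
qed

lemma quad_form_cong:
  "(\<And>i j. i < p \<Longrightarrow> j < p \<Longrightarrow> S i j = T i j) \<Longrightarrow> (\<And>i. i < p \<Longrightarrow> a i = b i) \<Longrightarrow>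
    quad_form p S a = quad_form p T b"
  unfolding quad_form_def by (intro sum.cong) auto

lemma matrix_root_exists:
  assumes "covariance_matrix p S"
  shows "\<exists>L. is_matrix_root p S L"
  using assms
proof (induction p arbitrary: S)
  case 0
  then show ?case by (simp add: is_matrix_root_def)
next
  case (Suc p)
  define d where "d = S p p"
  have sym: "\<forall>i<Suc p. \<forall>j<Suc p. S i j = S j i"
    and pos: "0 \<le> quad_form (Suc p) S a" for a
    using Suc.prems by (auto simp: covariance_matrix_def)
  have expand: "0 \<le> quad_form p S a + 2 * t * (\<Sum>i<p. a i * S i p) + t\<^sup>2 * d" for a t
  proof -
    have "quad_form (Suc p) S (a(p := t)) =
        quad_form p S (a(p := t)) + 2 * t * (\<Sum>i<p. (a(p := t)) i * S i p) + t\<^sup>2 * d"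
      by (simp only: quad_form_Suc[OF sym]) (simp add: d_def)
    moreover have "quad_form p S (a(p := t)) = quad_form p S a"
      by (rule quad_form_cong) auto
    moreover have "(\<Sum>i<p. (a(p := t)) i * S i p) = (\<Sum>i<p. a i * S i p)"
      by (rule sum.cong) auto
    ultimately show ?thesis using pos[of "a(p := t)"] by simp
  qed
  have d0: "0 \<le> d"
    using expand[of "\<lambda>_. 0" 1] by (simp add: quad_form_def)
  have zero: "(\<Sum>i<p. a i * S i p) = 0" if "d = 0" for a
  proof (rule ccontr)
    define w where "w = (\<Sum>i<p. a i * S i p)"
    assume "(\<Sum>i<p. a i * S i p) \<noteq> 0"
    then have "w \<noteq> 0" by (simp add: w_def)
    then show False
      using expand[of a "- (quad_form p S a + 1) / (2 * w)"] that
      unfolding w_def[symmetric] by (simp add: field_simps)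
  qed
  have col0: "S i p = 0" if "d = 0" "i < p" for i
  proof -
    have "(\<Sum>j<p. (if j = i then 1 else 0) * S j p) = 0"
      by (rule zero[OF that(1)])
    moreover have "(\<Sum>j<p. (if j = i then 1 else 0) * S j p) = (\<Sum>j<p. if j = i then S j p else 0)"
      by (intro sum.cong) auto
    ultimately show ?thesis using that(2) by simp
  qed
  define T where "T i j = S i j - S i p * S j p / d" for i j
  have "covariance_matrix p T"
    unfolding covariance_matrix_def
  proof (intro conjI allI impI)
    fix i j assume "i < p" "j < p"
    then show "T i j = T j i" using sym by (simp add: T_def algebra_simps)
  next
    fix a
    define w where "w = (\<Sum>i<p. a i * S i p)"
    have "quad_form p T a = quad_form p S a - (\<Sum>i<p. \<Sum>j<p. (a i * S i p) * (a j * S j p)) / d"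
      unfolding quad_form_def T_def
      by (simp add: sum_subtractf[symmetric] sum_divide_distrib algebra_simps)
    also have "(\<Sum>i<p. \<Sum>j<p. (a i * S i p) * (a j * S j p)) = w * w"
      by (simp add: w_def sum_product)
    finally have eq: "quad_form p T a = quad_form p S a - w * w / d" .
    show "0 \<le> quad_form p T a"
    proof (cases "d = 0")
      case True
      then show ?thesis using expand[of a 0] eq by simp
    next
      case False
      have "quad_form p S a + 2 * (- w / d) * w + (- w / d)\<^sup>2 * d = quad_form p S a - w * w / d"
        using False by (simp add: power2_eq_square field_simps)
      then show ?thesis using expand[of a "- w / d"] eq unfolding w_def[symmetric] by simp
    qed
  qed
  then obtain K where K: "is_matrix_root p T K" using Suc.IH by blast
  define L where "L i k = (if i < p then if k < p then K i k else S i p / sqrt d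
                           else if k < p then 0 else sqrt d)" for i k
  have "(\<Sum>k<Suc p. L i k * L j k) = S i j" if ij: "i < Suc p" "j < Suc p" for i j
  proof -
    have sq: "sqrt d * sqrt d = d" using d0 by simp
    have sp: "S p i = S i p" "S p j = S j p" using sym ij by auto
    have c: "S i p / sqrt d * sqrt d = S i p" if "i < p" for i
      using col0[OF _ that] by (cases "d = 0") auto
    consider "i < p" "j < p" | "i = p" "j < p" | "i < p" "j = p" | "i = p" "j = p"
      using ij by linarith
    then show ?thesis
    proof cases
      case 1
      have "(\<Sum>k<Suc p. L i k * L j k) = (\<Sum>k<p. K i k * K j k) + S i p / sqrt d * (S j p / sqrt d)"
        using 1 by (simp add: L_def)
      also have "\<dots> = T i j + S i p * S j p / d"
        using K 1 sq by (simp add: is_matrix_root_def)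
      finally show ?thesis by (simp add: T_def)
    next
      case 2
      then have "(\<Sum>k<Suc p. L i k * L j k) = S j p / sqrt d * sqrt d"
        by (simp add: L_def)
      then show ?thesis using c[OF 2(2)] 2 sp by simp
    next
      case 3
      then have "(\<Sum>k<Suc p. L i k * L j k) = S i p / sqrt d * sqrt d"
        by (simp add: L_def)
      then show ?thesis using c[OF 3(1)] 3 by simp
    next
      case 4
      then show ?thesis using sq by (simp add: L_def d_def)
    qed
  qed
  then show ?case unfolding is_matrix_root_def by blast
qed

lemma centred_normal_eq_density:
  assumes "0 < s2"
  shows "centred_normal s2 = density lborel (normal_density 0 (sqrt s2))"
proof -
  interpret prob_space std_normal_distribution
    by (rule prob_space_normal_density) simp
  have "distributed std_normal_distribution lborel (\<lambda>x. x) std_normal_density"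
    by (auto simp: distributed_def distr_id2)
  from normal_density_affine[OF this, of "sqrt s2" 0] assms
  have "distributed std_normal_distribution lborel (\<lambda>z. sqrt s2 * z) (normal_density 0 (sqrt s2))"
    by simp
  moreover have "distr std_normal_distribution lborel f = distr std_normal_distribution borel f"
    for f :: "real \<Rightarrow> real" by (rule distr_cong) auto
  ultimately show ?thesis
    by (simp add: distributed_def centred_normal_def)
qed

lemma distr_sum_std_normal:
  fixes c :: "nat \<Rightarrow> real"
  shows "distr (PiM {..<p} (\<lambda>_. std_normal_distribution)) borel (\<lambda>z. \<Sum>k<p. c k * z k) =
    centred_normal (\<Sum>k<p. (c k)\<^sup>2)"
proof -
  let ?N = "\<lambda>_::nat. std_normal_distribution"
  let ?M = "PiM {..<p} ?N"
  have pN: "prob_space std_normal_distribution"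
    by (rule prob_space_normal_density) simp
  interpret product_prob_space ?N "{..<p}"
    using pN by (simp add: product_prob_space_def product_prob_space_axioms_def
        product_sigma_finite_def prob_space_imp_sigma_finite)
  define I where "I = {k. k < p \<and> c k \<noteq> 0}"
  have fin: "finite I" by (simp add: I_def)
  have s1: "(\<Sum>k<p. c k * z k) = (\<Sum>k\<in>I. c k * z k)" for z :: "nat \<Rightarrow> real"
    by (rule sum.mono_neutral_right) (auto simp: I_def)
  have s2: "(\<Sum>k<p. (c k)\<^sup>2) = (\<Sum>k\<in>I. (c k)\<^sup>2)"
    by (rule sum.mono_neutral_right) (auto simp: I_def)
  show ?thesis
  proof (cases "I = {}")
    case True
    have "distr ?M borel (\<lambda>z. 0) = return borel (0::real)"
      by (rule distr_const) simp
    moreover have "distr std_normal_distribution borel (\<lambda>z. 0) = return borel (0::real)"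
      by (rule prob_space.distr_const[OF pN]) simp
    ultimately show ?thesis using True by (simp add: s1 s2 centred_normal_def)
  next
    case False
    have coord: "distributed ?M lborel (\<lambda>z. z k) std_normal_density" if "k < p" for k
    proof -
      have "distr ?M lborel (\<lambda>z. z k) = distr ?M std_normal_distribution (\<lambda>z. z k)"
        by (rule distr_cong) auto
      also have "\<dots> = std_normal_distribution"
        using that by (intro PiM_component) simp
      finally show ?thesis
        using that by (auto simp: distributed_def)
    qed
    have "distributed ?M lborel (\<lambda>z. c k * z k) (normal_density 0 \<bar>c k\<bar>)" if "k \<in> I" for k
      using normal_density_affine[OF coord, of k "c k" 0] that by (auto simp: I_def)
    moreover have "indep_vars (\<lambda>_. borel) (\<lambda>k z. c k * z k) I"
    proof -
      have ne: "{..<p} \<noteq> {}" using False by (auto simp: I_def)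
      have rv: "k \<in> {..<p} \<Longrightarrow> (\<lambda>z. z k) \<in> borel_measurable ?M" for k
        by simp
      have "distr ?M (PiM {..<p} (\<lambda>_. borel)) (\<lambda>z. \<lambda>k\<in>{..<p}. z k) = distr ?M ?M (\<lambda>z. z)"
        by (intro distr_cong sets_PiM_cong) (auto simp: space_PiM)
      also have "\<dots> = PiM {..<p} (\<lambda>k. distr ?M borel (\<lambda>z. z k))"
        unfolding distr_id
      proof (rule PiM_cong)
        fix k assume "k \<in> {..<p}"
        then have "distr ?M std_normal_distribution (\<lambda>z. z k) = std_normal_distribution"
          by (intro PiM_component)
        moreover have "distr ?M std_normal_distribution (\<lambda>z. z k) = distr ?M borel (\<lambda>z. z k)"
          by (rule distr_cong) auto
        ultimately show "std_normal_distribution = distr ?M borel (\<lambda>z. z k)" by simp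
      qed simp
      finally have "indep_vars (\<lambda>_. borel) (\<lambda>k z. z k) {..<p}"
        using indep_vars_iff_distr_eq_PiM'[OF ne rv] by simp
      then have "indep_vars (\<lambda>_. borel) (\<lambda>k z. z k) I"
        by (rule indep_vars_subset) (auto simp: I_def)
      then show ?thesis
        by (rule indep_vars_compose2) simp
    qed
    ultimately have "distributed ?M lborel (\<lambda>z. \<Sum>k\<in>I. c k * z k)
        (normal_density (\<Sum>k\<in>I. 0) (sqrt (\<Sum>k\<in>I. \<bar>c k\<bar>\<^sup>2)))"
      using False fin by (intro sum_indep_normal) (auto simp: I_def)
    then have "distr ?M lborel (\<lambda>z. \<Sum>k\<in>I. c k * z k) =
        density lborel (normal_density 0 (sqrt (\<Sum>k\<in>I. (c k)\<^sup>2)))"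
      by (simp add: distributed_def)
    moreover have "0 < (\<Sum>k\<in>I. (c k)\<^sup>2)"
      using False fin by (intro sum_pos) (auto simp: I_def)
    moreover have "distr ?M lborel (\<lambda>z. \<Sum>k\<in>I. c k * z k) = distr ?M borel (\<lambda>z. \<Sum>k\<in>I. c k * z k)"
      by (rule distr_cong) auto
    ultimately show ?thesis
      by (simp add: s1 s2 centred_normal_eq_density)
  qed
qed

lemma distr_mv_normal_inner_p:
  assumes "covariance_matrix p S"
  shows "distr (mv_normal p S) borel (inner_p p a) = centred_normal (quad_form p S a)"
proof -
  define L where "L = (SOME L. is_matrix_root p S L)"
  have L: "is_matrix_root p S L"
    unfolding L_def using matrix_root_exists[OF assms] by (rule someI_ex)
  let ?M = "PiM {..<p} (\<lambda>_::nat. std_normal_distribution)"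
  define c where "c k = (\<Sum>i<p. a i * L i k)" for k
  have m1: "(\<lambda>z. \<lambda>i\<in>{..<p}. \<Sum>k<p. L i k * z k) \<in> measurable ?M (vec_space p)"
    unfolding vec_space_def by measurable
  have m2: "inner_p p a \<in> borel_measurable (vec_space p)"
    unfolding vec_space_def inner_p_def[abs_def] by measurable
  have "inner_p p a (\<lambda>i\<in>{..<p}. \<Sum>k<p. L i k * z k) = (\<Sum>k<p. c k * z k)" for z
  proof -
    have "inner_p p a (\<lambda>i\<in>{..<p}. \<Sum>k<p. L i k * z k) = (\<Sum>i<p. \<Sum>k<p. a i * L i k * z k)"
      by (simp add: inner_p_def sum_distrib_left mult.assoc)
    also have "\<dots> = (\<Sum>k<p. \<Sum>i<p. a i * L i k * z k)" by (rule sum.swap)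
    finally show ?thesis by (simp add: c_def sum_distrib_right)
  qed
  then have "distr (mv_normal p S) borel (inner_p p a) = distr ?M borel (\<lambda>z. \<Sum>k<p. c k * z k)"
    unfolding mv_normal_def Let_def L_def[symmetric]
    by (simp add: distr_distr[OF m2 m1] comp_def)
  moreover have "(\<Sum>k<p. (c k)\<^sup>2) = quad_form p S a"
  proof -
    have "(\<Sum>k<p. (c k)\<^sup>2) = (\<Sum>k<p. \<Sum>i<p. \<Sum>j<p. (a i * L i k) * (a j * L j k))"
      by (simp add: c_def power2_eq_square sum_product)
    also have "\<dots> = (\<Sum>i<p. \<Sum>k<p. \<Sum>j<p. (a i * L i k) * (a j * L j k))"
      by (rule sum.swap)
    also have "\<dots> = (\<Sum>i<p. \<Sum>j<p. \<Sum>k<p. (a i * L i k) * (a j * L j k))"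
      by (intro sum.cong refl sum.swap)
    also have "\<dots> = (\<Sum>i<p. \<Sum>j<p. a i * (\<Sum>k<p. L i k * L j k) * a j)"
      by (simp add: sum_distrib_left sum_distrib_right algebra_simps)
    also have "\<dots> = quad_form p S a"
      unfolding quad_form_def using L by (intro sum.cong) (auto simp: is_matrix_root_def)
    finally show ?thesis .
  qed
  ultimately show ?thesis by (simp add: distr_sum_std_normal)
qed

end

theory Submission
  imports Defs
begin

text \<open>
  Fix \<open>n\<close> and write \<open>q = \<gamma>\<^sup>T \<Sigma>\<^sub>B \<gamma>\<close>, \<open>s\<^sup>2 = \<sigma>\<^sup>2\<^sub>u\<^sub>,\<^sub>B\<close> and \<open>\<tau> = q / s\<^sup>2\<close>. The hypotheses differ only in
  the regression vector of the second sample, and the regressors have the same law under both. So,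
  for \<open>s\<^sup>2 > 0\<close>, the log likelihood ratio is the sum over the second sample of
  \<open>((y - x\<^sup>T \<beta>)\<^sup>2 - (y - x\<^sup>T (\<beta> + \<gamma>))\<^sup>2) / (2 s\<^sup>2)\<close>. In terms of the signal \<open>v = x\<^sup>T \<gamma>\<close>, which is
  \<open>N(0, q)\<close>, and the noise \<open>u\<close>, a summand equals \<open>(2 u v - v\<^sup>2) / (2 s\<^sup>2)\<close> under the null and
  \<open>(2 u v + v\<^sup>2) / (2 s\<^sup>2)\<close> under the alternative. Hence the dimension enters only through \<open>\<tau>\<close>: the
  mean is \<open>-\<tau>/2\<close>, respectively \<open>\<tau>/2\<close>, the variance is \<open>\<tau> + \<tau>\<^sup>2/2\<close> in both cases, and the
  standardised summand is \<open>a G U \<plusminus> c (G\<^sup>2 - 1)\<close> with independent standard normal \<open>G\<close> and \<open>U\<close> and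
  \<open>a\<^sup>2 + 2 c\<^sup>2 = 1\<close> (\<open>obs_llr_null_law\<close>, \<open>obs_llr_alternative_law\<close>).

  The coefficients depend on \<open>n\<close> in an arbitrary way, but they are bounded by \<open>1\<close>, so the third
  moments are bounded uniformly and the standardised sums converge to the standard normal law under
  both hypotheses (\<open>clt_iid_rows\<close>, \<open>chaos_clt\<close>), uniformly in the argument of the distribution function
  (\<open>weak_conv_m_cdf_uniform\<close>). If \<open>t\<close> is the critical value standardised under the null, then
  standardising under the alternative subtracts the difference of the two means in units of the common
  standard deviation, which is \<open>n \<tau> / sqrt (n (\<tau> + \<tau>\<^sup>2/2)) = d\<^sub>n\<close>. The size condition forces \<open>t\<close> to
  converge to \<open>\<Phi>\<^sup>-\<^sup>1(1 - \<alpha>)\<close>, and the power \<open>1 - F\<^sub>1(t - d\<^sub>n)\<close> is asymptotically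
  \<open>\<Phi>(d\<^sub>n - t)\<close>, where \<open>F\<^sub>1\<close> is the distribution function of the standardised sum under the
  alternative (\<open>power_limit\<close>).

  Two degenerate cases remain. If \<open>q = 0\<close>, the two hypotheses give the same law, \<open>d\<^sub>n = 0\<close>, and the
  power is exactly \<open>\<alpha>\<close>. If \<open>q > 0\<close> and \<open>s\<^sup>2 = 0\<close>, the two laws are mutually singular and every
  likelihood ratio test with a finite critical value has size \<open>0\<close>, which contradicts \<open>\<alpha> > 0\<close>.
\<close>

lemma prob_space_std_normal: "prob_space std_normal_distribution"
  by (rule prob_space_normal_density) simp

section \<open>Sums over i.i.d. rows and their central limit theorem\<close>

lemma char_iid_sum:
  fixes f :: "'a \<Rightarrow> real"
  assumes "prob_space M" and f [measurable]: "f \<in> borel_measurable M"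
  shows "char (distr (PiM {..<n::nat} (\<lambda>_. M)) borel (\<lambda>w. \<Sum>i<n. f (w i))) t =
    char (distr M borel f) t ^ n"
proof -
  interpret M: prob_space M by fact
  interpret product_sigma_finite "\<lambda>_::nat. M" by standard
  have [measurable]: "(\<lambda>w. \<Sum>i<n. f (w i)) \<in> borel_measurable (PiM {..<n} (\<lambda>_. M))"
    by measurable
  have "char (distr (PiM {..<n} (\<lambda>_. M)) borel (\<lambda>w. \<Sum>i<n. f (w i))) t =
      (\<integral>w. (\<Prod>i<n. iexp (t * f (w i))) \<partial>PiM {..<n} (\<lambda>_. M))"
    by (simp add: char_def integral_distr exp_sum[symmetric] sum_distrib_left)
  also have "\<dots> = (\<Prod>i<n. \<integral>x. iexp (t * f x) \<partial>M)"
    by (intro product_integral_prod M.integrable_const_bound[where B = 1]) auto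
  also have "\<dots> = char (distr M borel f) t ^ n"
    by (simp add: char_def integral_distr)
  finally show ?thesis .
qed

lemma real_distribution_iid_sum:
  fixes f :: "'a \<Rightarrow> real"
  assumes "prob_space M" and f [measurable]: "f \<in> borel_measurable M"
  shows "real_distribution (distr (PiM {..<n::nat} (\<lambda>_. M)) borel (\<lambda>w. \<Sum>i<n. f (w i)))"
proof -
  interpret P: prob_space "PiM {..<n} (\<lambda>_. M)" using assms(1) by (rule prob_space_PiM)
  show ?thesis by (rule P.real_distribution_distr) measurable
qed

text \<open>
  This permits the summands, functions of the high-dimensional observations, to be replaced by a
  fixed function of two standard normal variables that has the same law.
\<close>

lemma iid_sum_law_cong:
  fixes f :: "'a \<Rightarrow> real" and g :: "'b \<Rightarrow> real"
  assumes "prob_space M" "f \<in> borel_measurable M" "prob_space N" "g \<in> borel_measurable N"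
    and "distr M borel f = distr N borel g"
  shows "distr (PiM {..<n::nat} (\<lambda>_. M)) borel (\<lambda>w. \<Sum>i<n. f (w i)) =
    distr (PiM {..<n} (\<lambda>_. N)) borel (\<lambda>w. \<Sum>i<n. g (w i))"
  using assms by (intro Levy_uniqueness real_distribution_iid_sum ext) (simp_all add: char_iid_sum)

text \<open>
  In a triangular array with i.i.d. rows the law of the summands may change with the row, so a
  central limit theorem for one fixed law is not enough. A bound on the third absolute moments that
  holds for all rows makes the error of the second order expansion of the characteristic function
  of one summand at \<open>t / sqrt n\<close> of order \<open>n powr (- 3 / 2)\<close> uniformly over the rows, and raising to the
  power \<open>n\<close> multiplies this error by at most \<open>n\<close>.
\<close>

lemma clt_iid_rows:
  fixes M :: "nat \<Rightarrow> 'a measure" and X :: "nat \<Rightarrow> 'a \<Rightarrow> real" and K :: real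
  assumes prob: "\<And>n. prob_space (M n)"
    and X: "\<And>n. X n \<in> borel_measurable (M n)"
    and int1: "\<And>n. integrable (M n) (X n)"
    and int2: "\<And>n. integrable (M n) (\<lambda>w. (X n w)\<^sup>2)"
    and int3: "\<And>n. integrable (M n) (\<lambda>w. \<bar>X n w\<bar> ^ 3)"
    and mean: "\<And>n. (\<integral>w. X n w \<partial>M n) = 0"
    and var: "\<And>n. (\<integral>w. (X n w)\<^sup>2 \<partial>M n) = 1"
    and third: "\<And>n. (\<integral>w. \<bar>X n w\<bar> ^ 3 \<partial>M n) \<le> K"
  shows "weak_conv_m (\<lambda>n. distr (PiM {..<n} (\<lambda>_. M n)) borel (\<lambda>w. \<Sum>i<n. X n (w i) / sqrt n))
    std_normal_distribution" (is "weak_conv_m ?S _")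
proof (rule levy_continuity)
  fix t :: real
  have bound: "cmod (char (?S n) t - (1 + (- (t\<^sup>2) / 2) / n) ^ n) \<le> \<bar>t\<bar> ^ 3 * K / 6 / sqrt n"
    if n: "n \<ge> max 1 (nat \<lceil>t\<^sup>2 / 4\<rceil>)" for n
  proof -
    interpret M: prob_space "M n" by (rule prob)
    have n1: "real n > 0" and n4: "t\<^sup>2 / 4 \<le> real n"
      using n by (auto simp: nat_ceiling_le_eq)
    define s where "s = t / sqrt n"
    define \<psi> where "\<psi> = char (distr (M n) borel (X n)) s"
    have s2: "s\<^sup>2 = t\<^sup>2 / n" using n1 by (simp add: s_def power_divide)
    have "char (distr (M n) borel (\<lambda>x. X n x / sqrt n)) t = \<psi>"
      unfolding char_def \<psi>_def s_def using X by (simp add: integral_distr)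
    then have char: "char (?S n) t = \<psi> ^ n"
      using char_iid_sum[OF prob, of "\<lambda>x. X n x / sqrt n" n n t] X by simp
    have "cmod (\<psi> - (1 - s\<^sup>2 * 1 / 2)) \<le>
        (s\<^sup>2 / 6) * (\<integral>w. min (6 * (X n w)\<^sup>2) (\<bar>s\<bar> * \<bar>X n w\<bar> ^ 3) \<partial>M n)"
      unfolding \<psi>_def using X int1 int2 mean var by (intro M.char_approx3') auto
    also have "\<dots> \<le> (s\<^sup>2 / 6) * (\<integral>w. \<bar>s\<bar> * \<bar>X n w\<bar> ^ 3 \<partial>M n)"
      using X int2 int3 by (intro mult_left_mono integral_mono integrable_min) auto
    also have "\<dots> \<le> (s\<^sup>2 / 6) * (\<bar>s\<bar> * K)"
      using third[of n] by (auto intro!: mult_left_mono)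
    finally have one: "cmod (\<psi> - (1 - s\<^sup>2 / 2)) \<le> (s\<^sup>2 / 6) * (\<bar>s\<bar> * K)" by simp
    have "cmod \<psi> \<le> 1"
      unfolding \<psi>_def using X by (intro real_distribution.cmod_char_le_1 M.real_distribution_distr)
    moreover have "cmod (complex_of_real (1 - s\<^sup>2 / 2)) \<le> 1"
      unfolding norm_of_real s2 using n4 n1 by (intro abs_leI) (auto simp: field_simps)
    ultimately have "cmod (\<psi> ^ n - complex_of_real (1 - s\<^sup>2 / 2) ^ n) \<le>
        n * cmod (\<psi> - complex_of_real (1 - s\<^sup>2 / 2))"
      by (rule norm_power_diff)
    also have "\<dots> \<le> n * ((s\<^sup>2 / 6) * (\<bar>s\<bar> * K))"
      using one by (intro mult_left_mono) auto
    also have "\<dots> = \<bar>t\<bar> ^ 3 * K / 6 / sqrt n"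
    proof -
      have "n * s\<^sup>2 = t\<^sup>2" using n1 s2 by simp
      moreover have "\<bar>t\<bar> ^ 3 = t\<^sup>2 * \<bar>t\<bar>" by (simp add: power3_eq_cube power2_eq_square)
      moreover have "\<bar>s\<bar> = \<bar>t\<bar> / sqrt n" using n1 by (simp add: s_def)
      moreover have "n * ((s\<^sup>2 / 6) * (\<bar>s\<bar> * K)) = n * s\<^sup>2 * \<bar>s\<bar> * K / 6" by simp
      ultimately show ?thesis by simp
    qed
    finally show ?thesis by (simp add: char s2 mult.commute)
  qed
  have lim: "(\<lambda>n. \<bar>t\<bar> ^ 3 * K / 6 / sqrt (real n)) \<longlonglongrightarrow> 0"
    by (intro tendsto_divide_0[OF tendsto_const] filterlim_at_top_imp_at_infinity
        sqrt_at_top[THEN filterlim_compose] filterlim_real_sequentially)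
  have "\<forall>\<^sub>F n in sequentially. cmod (char (?S n) t - (1 + (- (t\<^sup>2) / 2) / n) ^ n) \<le>
      \<bar>t\<bar> ^ 3 * K / 6 / sqrt n"
    by (rule eventually_sequentiallyI, rule bound)
  from Lim_null_comparison[OF this lim]
  have "(\<lambda>n. char (?S n) t - complex_of_real ((1 + (- (t\<^sup>2) / 2) / n) ^ n)) \<longlonglongrightarrow> 0"
    by simp
  moreover have "(\<lambda>n. complex_of_real ((1 + (- (t\<^sup>2) / 2) / n) ^ n)) \<longlonglongrightarrow>
      complex_of_real (exp (- (t\<^sup>2) / 2))"
    by (rule isCont_tendsto_compose [OF _ tendsto_exp_limit_sequentially]) auto
  ultimately have "(\<lambda>n. char (?S n) t) \<longlonglongrightarrow> complex_of_real (exp (- (t\<^sup>2) / 2))"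
    by (rule Lim_transform[rotated])
  then show "(\<lambda>n. char (?S n) t) \<longlonglongrightarrow> char std_normal_distribution t"
    by (simp add: char_std_normal_distribution)
qed (use X in \<open>auto intro!: real_dist_normal_dist real_distribution_iid_sum prob\<close>)

section \<open>Uniform convergence of distribution functions\<close>

text \<open>
  Polya's theorem. The power is a distribution function evaluated at the point \<open>t n - d n\<close>, which may
  run off to infinity or oscillate, so pointwise convergence would not do. The proof compares
  the monotone functions at the points where the limit takes the values \<open>j / K\<close>: if they differ by less
  than \<open>1 / K\<close> at these finitely many points, they differ by at most \<open>2 / K\<close> everywhere.
\<close>

lemma weak_conv_m_cdf_uniform:
  fixes M :: "nat \<Rightarrow> real measure"
  assumes M: "\<And>n. real_distribution (M n)" and N: "real_distribution N"
    and conv: "weak_conv_m M N" and cont: "\<And>x. isCont (cdf N) x" and "0 < e"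
  shows "\<forall>\<^sub>F n in sequentially. \<forall>x. \<bar>cdf (M n) x - cdf N x\<bar> < e"
proof -
  interpret M: real_distribution "M n" for n by (rule M)
  interpret N: real_distribution N by (rule N)
  obtain K :: nat where "2 / e < K" using reals_Archimedean2 by blast
  moreover have "0 < 2 / e" using \<open>0 < e\<close> by simp
  ultimately have pos: "0 < real K" by linarith
  then have "0 < K" "2 / K < e"
    using \<open>2 / e < K\<close> \<open>0 < e\<close> by (simp_all add: field_simps)
  note K = this
  have "\<exists>x. cdf N x = j / K" if j: "1 \<le> j" "j < K" for j :: nat
  proof -
    have "0 < real j / K" "real j / K < 1" using j K by auto
    then have "\<forall>\<^sub>F x in at_bot. cdf N x < j / K" "\<forall>\<^sub>F x in at_top. j / K < cdf N x"
      using N.cdf_lim_at_bot N.cdf_lim_at_top_prob by (auto simp: order_tendsto_iff)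
    then obtain u v where uv: "\<And>x. x \<le> u \<Longrightarrow> cdf N x < j / K" "\<And>x. v \<le> x \<Longrightarrow> j / K < cdf N x"
      unfolding eventually_at_bot_linorder eventually_at_top_linorder by blast
    have "u \<le> v" using uv(1)[of u] uv(2)[of u] by (rule_tac ccontr) auto
    then show ?thesis
      using IVT[of "cdf N" u "j / K" v] uv(1)[of u] uv(2)[of v] cont by auto
  qed
  then obtain g where g: "\<And>j::nat. 1 \<le> j \<Longrightarrow> j < K \<Longrightarrow> cdf N (g j) = j / K"
    by metis
  have "\<forall>\<^sub>F n in sequentially. \<forall>j\<in>{1..<K}. \<bar>cdf (M n) (g j) - j / K\<bar> < 1 / K"
  proof (rule eventually_ball_finite[rule_format], simp)
    fix j assume j: "j \<in> {1..<K}"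
    have "(\<lambda>n. cdf (M n) (g j)) \<longlonglongrightarrow> j / K"
      using conv cont[of "g j"] g[of j] j unfolding weak_conv_m_def weak_conv_def by auto
    then show "\<forall>\<^sub>F n in sequentially. \<bar>cdf (M n) (g j) - j / K\<bar> < 1 / K"
      using K by (auto simp: tendsto_iff dist_real_def)
  qed
  then show ?thesis
  proof (rule eventually_mono, intro allI)
    fix n x
    assume close: "\<forall>j\<in>{1..<K}. \<bar>cdf (M n) (g j) - j / K\<bar> < 1 / K"
    define F where "F = cdf N x"
    have F: "0 \<le> F" "F \<le> 1" by (auto simp: F_def N.cdf_nonneg N.cdf_bounded_prob)
    have "cdf (M n) x \<le> F + 2 / K"
    proof -
      \<comment> \<open>the least \<open>j\<close> with \<open>F < j / K\<close>, strictly, so that \<open>x\<close> lies to the left of the quantile \<open>g j\<close>\<close>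
      define j where "j = nat \<lfloor>K * F\<rfloor> + 1"
      have "K * F < j" "j \<le> K * F + 1" using F by (auto simp: j_def) linarith+
      then have j: "F < j / K" "j / K \<le> F + 1 / K" using K by (auto simp: field_simps)
      show ?thesis
      proof (cases "j < K")
        case True
        then have jK: "1 \<le> j" "j < K" by (auto simp: j_def)
        have "x \<le> g j"
          using N.cdf_nondecreasing[of "g j" x] g[OF jK] j(1) by (force simp: F_def)
        then have "cdf (M n) x \<le> cdf (M n) (g j)" by (rule M.cdf_nondecreasing)
        also have "\<dots> < j / K + 1 / K" using close jK by (auto dest!: bspec[of _ _ j])
        finally show ?thesis using j(2) by simp
      next
        case False
        then have "1 \<le> real j / K" using K by simp
        moreover have "1 / real K \<le> 2 / K" by (simp add: divide_right_mono)
        ultimately show ?thesis using M.cdf_bounded_prob[of n x] j(2) by linarith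
      qed
    qed
    moreover have "F - 2 / K \<le> cdf (M n) x"
    proof -
      \<comment> \<open>the greatest \<open>j\<close> with \<open>j / K < F\<close>, or \<open>0\<close> if \<open>F = 0\<close>\<close>
      define j where "j = nat (\<lceil>K * F\<rceil> - 1)"
      show ?thesis
      proof (cases "1 \<le> j")
        case True
        then have "j < K * F" "K * F \<le> j + 1" by (auto simp: j_def) linarith+
        then have j: "j / K < F" "F \<le> j / K + 1 / K" using K by (auto simp: field_simps)
        have "real j / K < 1" using j(1) F(2) by linarith
        then have jK: "j < K" using K by simp
        have "g j \<le> x"
          using N.cdf_nondecreasing[of x "g j"] g[OF True jK] j(1) by (force simp: F_def)
        then have "cdf (M n) (g j) \<le> cdf (M n) x" by (rule M.cdf_nondecreasing)
        moreover have "j / K - 1 / K < cdf (M n) (g j)"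
          using close True jK by (auto dest!: bspec[of _ _ j])
        ultimately show ?thesis using j(2) by simp
      next
        case False
        then have "\<lceil>K * F\<rceil> \<le> 1" unfolding j_def by linarith
        then have "K * F \<le> 1" by (simp only: ceiling_le_iff of_int_1)
        then have "F \<le> 1 / K" using K(1) by (simp add: field_simps)
        moreover have "1 / real K \<le> 2 / K" by (simp add: divide_right_mono)
        ultimately show ?thesis using M.cdf_nonneg[of n x] by linarith
      qed
    qed
    ultimately show "\<bar>cdf (M n) x - cdf N x\<bar> < e" using K(2) by (simp add: F_def)
  qed
qed

section \<open>The standard normal distribution function\<close>

interpretation std_normal: real_distribution std_normal_distribution
  by (rule real_dist_normal_dist)

lemma Phi_mono: "x \<le> y \<Longrightarrow> Phi x \<le> Phi y"
  unfolding Phi_def by (rule std_normal.cdf_nondecreasing)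

lemma Phi_diff: "x < y \<Longrightarrow> Phi y - Phi x = measure std_normal_distribution {x<..y}"
  unfolding Phi_def by (rule std_normal.cdf_diff_eq)

lemma Phi_strict_mono: assumes "x < y" shows "Phi x < Phi y"
proof -
  have "measure std_normal_distribution {x<..y} \<noteq> 0"
  proof
    assume "measure std_normal_distribution {x<..y} = 0"
    then have "{x<..y} \<in> null_sets std_normal_distribution"
      by (auto simp: std_normal.emeasure_eq_measure null_sets_def)
    then have "AE z\<in>{x<..y} in lborel. std_normal_density z = 0"
      by (simp add: null_sets_density_iff ennreal_eq_0_iff antisym_conv normal_density_nonneg)
    then have "AE z in lborel. z \<notin> {x<..y}"
      by eventually_elim (use normal_density_pos[of 1 0] in \<open>auto simp: less_le\<close>)
    then have "emeasure lborel {x<..y} = 0"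
      using AE_iff_null_sets[of "{x<..y}" lborel] by auto
    then show False using assms by simp
  qed
  then show ?thesis
    using Phi_diff[OF assms] zero_less_measure_iff[of std_normal_distribution "{x<..y}"] by linarith
qed

lemma std_normal_density_le_1: "std_normal_density x \<le> 1"
proof -
  have "1 \<le> sqrt (2 * pi)" using pi_gt3 by simp
  moreover have "exp (- x\<^sup>2 / 2) \<le> 1" by simp
  ultimately have "exp (- x\<^sup>2 / 2) \<le> sqrt (2 * pi)" by linarith
  moreover have "0 < sqrt (2 * pi)" by simp
  ultimately show ?thesis
    unfolding std_normal_density_def by (simp add: divide_le_eq_1 del: real_sqrt_gt_0_iff)
qed

text \<open>
  The standard normal density is bounded by \<open>1\<close>. The Lipschitz bound is what turns convergence of the
  critical values into convergence of the power, uniformly in \<open>d n\<close>.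
\<close>

lemma Phi_lipschitz: "\<bar>Phi x - Phi y\<bar> \<le> \<bar>x - y\<bar>"
proof -
  have *: "Phi y - Phi x \<le> y - x" if "x < y" for x y
  proof -
    have "emeasure std_normal_distribution {x<..y} =
        (\<integral>\<^sup>+z. ennreal (std_normal_density z) * indicator {x<..y} z \<partial>lborel)"
      by (simp add: emeasure_density)
    also have "\<dots> \<le> (\<integral>\<^sup>+z. indicator {x<..y} z \<partial>lborel)"
    proof (rule nn_integral_mono)
      fix z
      have "ennreal (std_normal_density z) \<le> ennreal 1"
        by (rule ennreal_leI) (rule std_normal_density_le_1)
      then show "ennreal (std_normal_density z) * indicator {x<..y} z \<le> indicator {x<..y} z"
        by (simp split: split_indicator)
    qed
    also have "\<dots> = ennreal (y - x)" using that by simp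
    finally show ?thesis
      using that by (simp add: Phi_diff std_normal.emeasure_eq_measure)
  qed
  show ?thesis
    using *[of x y] *[of y x] Phi_mono[of x y] Phi_mono[of y x]
    by (cases x y rule: linorder_cases) (simp_all add: abs_if)
qed

lemma isCont_Phi: "isCont Phi x"
proof -
  have "((\<lambda>y. \<bar>Phi y - Phi x\<bar>) \<longlongrightarrow> 0) (at x)"
  proof (rule tendsto_sandwich[OF _ _ tendsto_const])
    show "((\<lambda>y. \<bar>y - x\<bar>) \<longlongrightarrow> 0) (at x)"
      by (intro tendsto_eq_intros) auto
  qed (auto simp: Phi_lipschitz)
  then show ?thesis
    unfolding isCont_def tendsto_rabs_zero_iff by (rule LIM_zero_cancel)
qed

lemma Phi_minus: "Phi (- x) = 1 - Phi x"
proof -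
  have "distributed std_normal_distribution lborel (\<lambda>x. x) std_normal_density"
    by (auto simp: distributed_def distr_id2)
  from std_normal.normal_density_affine[OF this, of "-1" 0]
  have "distr std_normal_distribution lborel uminus = std_normal_distribution"
    by (simp add: distributed_def)
  moreover have "distr std_normal_distribution lborel uminus =
      distr std_normal_distribution borel (uminus :: real \<Rightarrow> real)"
    by (rule distr_cong) auto
  ultimately have "Phi (- x) = measure (distr std_normal_distribution borel uminus) {..- x}"
    by (simp add: Phi_def cdf_def)
  also have "\<dots> = measure std_normal_distribution {x..}"
    by (subst measure_distr) (auto simp: vimage_def atLeast_def)
  also have "{x..} = space std_normal_distribution - {..<x}" by auto
  also have "measure std_normal_distribution \<dots> = 1 - measure std_normal_distribution {..<x}"
    by (rule std_normal.prob_compl) simp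
  also have "measure std_normal_distribution {..<x} = Phi x"
  proof -
    have "measure std_normal_distribution {x} = 0"
      using isCont_Phi[of x] by (simp add: Phi_def std_normal.isCont_cdf)
    moreover have "{..x} = {..<x} \<union> {x}" by auto
    ultimately show ?thesis
      unfolding Phi_def cdf_def by (simp add: std_normal.finite_measure_Union del: Un_insert_right)
  qed
  finally show ?thesis .
qed

lemma Phi_Phi_inv: assumes "0 < q" "q < 1" shows "Phi (Phi_inv q) = q"
proof -
  have "\<forall>\<^sub>F x in at_bot. Phi x < q" "\<forall>\<^sub>F x in at_top. q < Phi x"
    using std_normal.cdf_lim_at_bot std_normal.cdf_lim_at_top_prob assms
    by (auto simp: order_tendsto_iff Phi_def)
  then obtain u v where uv: "\<And>x. x \<le> u \<Longrightarrow> Phi x < q" "\<And>x. v \<le> x \<Longrightarrow> q < Phi x"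
    unfolding eventually_at_bot_linorder eventually_at_top_linorder by blast
  have "u \<le> v" using uv(1)[of u] uv(2)[of u] by (rule_tac ccontr) auto
  then obtain z where z: "Phi z = q"
    using IVT[of Phi u q v] uv(1)[of u] uv(2)[of v] isCont_Phi by auto
  have "y = z" if "Phi y = q" for y
    using Phi_strict_mono[of y z] Phi_strict_mono[of z y] that z by (metis linorder_neqE order_less_irrefl)
  with z show ?thesis
    unfolding Phi_inv_def by (rule theI)
qed

section \<open>The law of a standardised log likelihood increment\<close>

abbreviation std_pair :: "(real \<times> real) measure" where
  "std_pair \<equiv> std_normal_distribution \<Otimes>\<^sub>M std_normal_distribution"

lemma prob_space_std_pair: "prob_space std_pair"
  using prob_space_std_normal by (intro prob_space_pair)

lemma std_pair_monomial:
  "has_bochner_integral std_pair (\<lambda>w. fst w ^ i * snd w ^ j)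
     ((\<integral>x. x ^ i \<partial>std_normal_distribution) * (\<integral>x. x ^ j \<partial>std_normal_distribution))"
proof -
  interpret pair_prob_space std_normal_distribution std_normal_distribution by standard
  note [simp] = integrable_std_normal_distribution_moment
  have abs_int: "integrable std_normal_distribution (\<lambda>x. \<bar>x\<bar> ^ i)" for i
    using integrable_abs[OF integrable_std_normal_distribution_moment[of i]] by (simp add: power_abs)
  have int: "integrable std_pair (\<lambda>w. fst w ^ i * snd w ^ j)"
    by (rule Fubini_integrable) (auto simp: abs_mult power_abs abs_int)
  from integral_fst'[OF this] show ?thesis
    using int by (simp add: has_bochner_integral_iff)
qed

text \<open>
  The standardised increment of the log likelihood ratio: \<open>fst w\<close> is the standardised signal
  \<open>x\<^sup>T \<gamma>\<close> and \<open>snd w\<close> the standardised noise. The two summands are uncorrelated with variances \<open>a\<^sup>2\<close> and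
  \<open>2 c\<^sup>2\<close>.
\<close>

definition chaos :: "real \<Rightarrow> real \<Rightarrow> real \<times> real \<Rightarrow> real" where
  "chaos a c w = a * (fst w * snd w) + c * ((fst w)\<^sup>2 - 1)"

definition chaos_law :: "nat \<Rightarrow> real \<Rightarrow> real \<Rightarrow> real measure" where
  "chaos_law n a c =
     distr (PiM {..<n} (\<lambda>_. std_pair)) borel (\<lambda>w. \<Sum>i<n. chaos a c (w i) / sqrt n)"

lemma measurable_chaos [measurable]: "chaos a c \<in> borel_measurable std_pair"
  unfolding chaos_def[abs_def] by measurable

lemma real_distribution_chaos_law: "real_distribution (chaos_law n a c)"
  unfolding chaos_law_def by (intro real_distribution_iid_sum prob_space_std_pair) measurable

lemma chaos_monomials:
  "chaos a c w = a * (fst w ^ 1 * snd w ^ 1) + c * (fst w ^ 2 * snd w ^ 0)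
     - c * (fst w ^ 0 * snd w ^ 0)"
  by (simp add: chaos_def algebra_simps)

lemma chaos_sq_monomials:
  "(chaos a c w)\<^sup>2 = a\<^sup>2 * (fst w ^ 2 * snd w ^ 2)
     + 2 * a * c * (fst w ^ 3 * snd w ^ 1) - 2 * a * c * (fst w ^ 1 * snd w ^ 1)
     + c\<^sup>2 * (fst w ^ 4 * snd w ^ 0) - 2 * c\<^sup>2 * (fst w ^ 2 * snd w ^ 0)
     + c\<^sup>2 * (fst w ^ 0 * snd w ^ 0)"
  unfolding chaos_def power_0 power_one_right mult_1_right by algebra

text \<open>
  A dominating function for the third absolute moment that does not depend on the coefficients.
\<close>

definition chaos_bound :: "real \<times> real \<Rightarrow> real" where
  "chaos_bound w = (1 + 2 * (fst w)\<^sup>2 + (snd w)\<^sup>2) ^ 3"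

lemma chaos_bound_monomials:
  "chaos_bound w = fst w ^ 0 * snd w ^ 0 + 6 * (fst w ^ 2 * snd w ^ 0) + 3 * (fst w ^ 0 * snd w ^ 2)
     + 12 * (fst w ^ 4 * snd w ^ 0) + 12 * (fst w ^ 2 * snd w ^ 2) + 3 * (fst w ^ 0 * snd w ^ 4)
     + 8 * (fst w ^ 6 * snd w ^ 0) + 12 * (fst w ^ 4 * snd w ^ 2) + 6 * (fst w ^ 2 * snd w ^ 4)
     + fst w ^ 0 * snd w ^ 6"
  unfolding chaos_bound_def power_0 mult_1_right mult_1_left by algebra

lemma abs_chaos_le:
  assumes "a\<^sup>2 + 2 * c\<^sup>2 = 1"
  shows "\<bar>chaos a c w\<bar> ^ 3 \<le> chaos_bound w"
proof -
  have "a\<^sup>2 \<le> 1" "c\<^sup>2 \<le> 1"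
    using assms zero_le_power2[of a] zero_le_power2[of c] by linarith+
  then have a: "\<bar>a\<bar> \<le> 1" and c: "\<bar>c\<bar> \<le> 1"
    by (simp_all add: abs_square_le_1)
  have "\<bar>chaos a c w\<bar> \<le> \<bar>a\<bar> * \<bar>fst w * snd w\<bar> + \<bar>c\<bar> * \<bar>(fst w)\<^sup>2 - 1\<bar>"
    unfolding chaos_def abs_mult[of a, symmetric] abs_mult[of c, symmetric] by (rule abs_triangle_ineq)
  also have "\<dots> \<le> 1 * \<bar>fst w * snd w\<bar> + 1 * \<bar>(fst w)\<^sup>2 - 1\<bar>"
    by (rule add_mono[OF mult_right_mono[OF a] mult_right_mono[OF c]]) (rule abs_ge_zero)+
  also have "\<dots> \<le> ((fst w)\<^sup>2 + (snd w)\<^sup>2) + (1 + (fst w)\<^sup>2)"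
  proof -
    have "x * y \<le> x\<^sup>2 + y\<^sup>2" for x y :: real
      using sum_squares_bound[of x y] zero_le_power2[of x] zero_le_power2[of y] by linarith
    from this[of "\<bar>fst w\<bar>" "\<bar>snd w\<bar>"] have "\<bar>fst w * snd w\<bar> \<le> (fst w)\<^sup>2 + (snd w)\<^sup>2"
      by (simp add: abs_mult)
    moreover have "\<bar>(fst w)\<^sup>2 - 1\<bar> \<le> 1 + (fst w)\<^sup>2" by (simp add: abs_if)
    ultimately show ?thesis by simp
  qed
  finally have "\<bar>chaos a c w\<bar> \<le> 1 + 2 * (fst w)\<^sup>2 + (snd w)\<^sup>2" by simp
  then show ?thesis unfolding chaos_bound_def by (rule power_mono) (rule abs_ge_zero)
qed

lemma std_normal_moments:
  "(\<integral>x. x ^ 0 \<partial>std_normal_distribution) = 1"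
  "(\<integral>x. x ^ 1 \<partial>std_normal_distribution) = 0"
  "(\<integral>x. x ^ 2 \<partial>std_normal_distribution) = 1"
  "(\<integral>x. x ^ 3 \<partial>std_normal_distribution) = 0"
  "(\<integral>x. x ^ 4 \<partial>std_normal_distribution) = 3"
proof -
  show "(\<integral>x. x ^ 0 \<partial>std_normal_distribution) = 1"
    using std_normal_distribution_even_moments[of 0] by (simp add: fact_numeral)
  show "(\<integral>x. x ^ 1 \<partial>std_normal_distribution) = 0"
    by (rule integral_std_normal_distribution_moment_odd) simp
  show "(\<integral>x. x ^ 3 \<partial>std_normal_distribution) = 0"
    by (rule integral_std_normal_distribution_moment_odd) simp
  show "(\<integral>x. x ^ 2 \<partial>std_normal_distribution) = 1"
    using std_normal_distribution_even_moments[of 1] by (simp add: fact_numeral)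
  show "(\<integral>x. x ^ 4 \<partial>std_normal_distribution) = 3"
    using std_normal_distribution_even_moments[of 2] by (simp add: fact_numeral)
qed

text \<open>
  Since the coefficients may vary with \<open>n\<close> in any way that keeps the variance equal to \<open>1\<close>, the
  limit is uniform over all signal-to-noise ratios.
\<close>

lemma chaos_clt:
  assumes ac: "\<And>n. (a n)\<^sup>2 + 2 * (c n)\<^sup>2 = 1"
  shows "weak_conv_m (\<lambda>n. chaos_law n (a n) (c n)) std_normal_distribution"
  unfolding chaos_law_def
proof (rule clt_iid_rows)
  fix n
  show "prob_space std_pair" by (rule prob_space_std_pair)
  show "chaos (a n) (c n) \<in> borel_measurable std_pair" by measurable
  note intros = has_bochner_integral_add has_bochner_integral_diff has_bochner_integral_mult_right
    std_pair_monomial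
  let ?E = "\<lambda>i. \<integral>x. x ^ i \<partial>std_normal_distribution"
  have "has_bochner_integral std_pair (chaos (a n) (c n))
      (a n * (?E 1 * ?E 1) + c n * (?E 2 * ?E 0) - c n * (?E 0 * ?E 0))"
    unfolding chaos_monomials[abs_def] by (intro intros)
  then have one: "has_bochner_integral std_pair (chaos (a n) (c n)) 0"
    unfolding std_normal_moments by simp
  then show "integrable std_pair (chaos (a n) (c n))" "(\<integral>w. chaos (a n) (c n) w \<partial>std_pair) = 0"
    by (simp_all only: has_bochner_integral_iff)
  have "has_bochner_integral std_pair (\<lambda>w. (chaos (a n) (c n) w)\<^sup>2)
      ((a n)\<^sup>2 * (?E 2 * ?E 2) + 2 * a n * c n * (?E 3 * ?E 1) - 2 * a n * c n * (?E 1 * ?E 1)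
        + (c n)\<^sup>2 * (?E 4 * ?E 0) - 2 * (c n)\<^sup>2 * (?E 2 * ?E 0) + (c n)\<^sup>2 * (?E 0 * ?E 0))"
    unfolding chaos_sq_monomials[abs_def] by (intro intros)
  then have "has_bochner_integral std_pair (\<lambda>w. (chaos (a n) (c n) w)\<^sup>2) ((a n)\<^sup>2 + 2 * (c n)\<^sup>2)"
    unfolding std_normal_moments by (simp add: add.commute)
  then show "integrable std_pair (\<lambda>w. (chaos (a n) (c n) w)\<^sup>2)"
      "(\<integral>w. (chaos (a n) (c n) w)\<^sup>2 \<partial>std_pair) = 1"
    unfolding ac by (simp_all only: has_bochner_integral_iff)
  have bound: "integrable std_pair chaos_bound"
    unfolding chaos_bound_monomials[abs_def]
    by (intro Bochner_Integration.integrable_add integrable_mult_right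
        integrable.intros[OF std_pair_monomial])
  show third: "integrable std_pair (\<lambda>w. \<bar>chaos (a n) (c n) w\<bar> ^ 3)"
  proof (rule Bochner_Integration.integrable_bound[OF bound])
    show "AE w in std_pair. norm (\<bar>chaos (a n) (c n) w\<bar> ^ 3) \<le> norm (chaos_bound w)"
    proof (rule AE_I2)
      fix w
      have "norm (\<bar>chaos (a n) (c n) w\<bar> ^ 3) = \<bar>chaos (a n) (c n) w\<bar> ^ 3" by simp
      also have "\<dots> \<le> chaos_bound w" by (rule abs_chaos_le[OF ac])
      also have "\<dots> \<le> norm (chaos_bound w)" by simp
      finally show "norm (\<bar>chaos (a n) (c n) w\<bar> ^ 3) \<le> norm (chaos_bound w)" .
    qed
  qed measurable
  show "(\<integral>w. \<bar>chaos (a n) (c n) w\<bar> ^ 3 \<partial>std_pair) \<le> (\<integral>w. chaos_bound w \<partial>std_pair)"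
    by (intro integral_mono third bound abs_chaos_le ac)
qed

section \<open>One observation of the regression model\<close>

lemma sets_mv_normal [measurable_cong, simp]: "sets (mv_normal p S) = sets (vec_space p)"
  by (simp add: mv_normal_def Let_def)

lemma prob_space_mv_normal: "prob_space (mv_normal p S)"
proof -
  have "prob_space (PiM {..<p} (\<lambda>_::nat. std_normal_distribution))"
    by (intro prob_space_PiM prob_space_std_normal)
  then show ?thesis
    unfolding mv_normal_def Let_def vec_space_def by (rule prob_space.prob_space_distr) measurable
qed

lemma sets_centred_normal [measurable_cong, simp]: "sets (centred_normal s2) = sets borel"
  by (simp add: centred_normal_def)

lemma prob_space_centred_normal: "prob_space (centred_normal s2)"
  unfolding centred_normal_def by (rule prob_space.prob_space_distr[OF prob_space_std_normal]) measurable

lemma measurable_inner_p [measurable]: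
  "(\<lambda>x. inner_p p x b) \<in> borel_measurable (vec_space p)"
  unfolding inner_p_def vec_space_def by measurable

lemma inner_p_commute: "inner_p p a b = inner_p p b a"
  by (simp add: inner_p_def mult.commute)

lemma inner_p_add: "inner_p p x (\<lambda>j. b j + g j) = inner_p p x b + inner_p p x g"
  by (simp add: inner_p_def distrib_left sum.distrib)

lemma sets_obs_law [measurable_cong, simp]:
  "sets (obs_law p S s2 b) = sets (vec_space p \<Otimes>\<^sub>M borel)"
  by (simp add: obs_law_def)

lemma prob_space_obs_law: "prob_space (obs_law p S s2 b)"
  unfolding obs_law_def
  by (intro prob_space.prob_space_distr prob_space_pair prob_space_mv_normal
      prob_space_centred_normal) measurable

text \<open>
  The dimension disappears here: \<open>x\<close> is seen only through the scalar \<open>x\<^sup>T g\<close>, which is normal with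
  variance \<open>quad_form p S g\<close> and independent of the noise.
\<close>

lemma obs_law_signal_noise:
  assumes S: "covariance_matrix p S" and h [measurable]: "h \<in> borel_measurable (borel \<Otimes>\<^sub>M borel)"
  shows "distr (obs_law p S s2 b) borel (\<lambda>z. h (inner_p p (fst z) g, snd z - inner_p p (fst z) b)) =
    distr std_pair borel (\<lambda>w. h (sqrt (quad_form p S g) * fst w, sqrt s2 * snd w))"
proof -
  have "distr (obs_law p S s2 b) borel (\<lambda>z. h (inner_p p (fst z) g, snd z - inner_p p (fst z) b)) =
      distr (mv_normal p S \<Otimes>\<^sub>M centred_normal s2) borel (\<lambda>(x, u). h (inner_p p x g, u))"
    unfolding obs_law_def
    by (subst distr_distr, measurable, simp add: comp_def case_prod_unfold)
  also have "\<dots> = distr (distr (mv_normal p S \<Otimes>\<^sub>M centred_normal s2) (borel \<Otimes>\<^sub>M borel)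
      (\<lambda>(x, u). (inner_p p x g, u))) borel h"
    by (subst distr_distr, measurable, simp add: comp_def case_prod_unfold)
  also have "distr (mv_normal p S \<Otimes>\<^sub>M centred_normal s2) (borel \<Otimes>\<^sub>M borel)
      (\<lambda>(x, u). (inner_p p x g, u)) =
      distr (mv_normal p S) borel (\<lambda>x. inner_p p x g) \<Otimes>\<^sub>M distr (centred_normal s2) borel (\<lambda>u. u)"
  proof (rule pair_measure_distr[symmetric])
    show "sigma_finite_measure (distr (centred_normal s2) borel (\<lambda>u. u))"
      by (intro prob_space_imp_sigma_finite prob_space.prob_space_distr prob_space_centred_normal)
        measurable
  qed measurable
  also have "distr (mv_normal p S) borel (\<lambda>x. inner_p p x g) = centred_normal (quad_form p S g)"
  proof -
    have "(\<lambda>x. inner_p p x g) = inner_p p g" by (rule ext) (rule inner_p_commute)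
    then show ?thesis using distr_mv_normal_inner_p[OF S, of g] by (simp only:)
  qed
  also have "distr (centred_normal s2) borel (\<lambda>u. u) = centred_normal s2"
    by (rule distr_id2) simp
  also have "centred_normal (quad_form p S g) \<Otimes>\<^sub>M centred_normal s2 =
      distr std_pair (borel \<Otimes>\<^sub>M borel) (\<lambda>(v, u). (sqrt (quad_form p S g) * v, sqrt s2 * u))"
    using prob_space_imp_sigma_finite[OF prob_space_centred_normal[of s2]]
    unfolding centred_normal_def by (intro pair_measure_distr) measurable
  also have "distr (distr std_pair (borel \<Otimes>\<^sub>M borel)
      (\<lambda>(v, u). (sqrt (quad_form p S g) * v, sqrt s2 * u))) borel h =
      distr std_pair borel (\<lambda>w. h (sqrt (quad_form p S g) * fst w, sqrt s2 * snd w))"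
    by (subst distr_distr, measurable, simp add: comp_def case_prod_unfold)
  finally show ?thesis .
qed

text \<open>
  The law of \<open>x\<close> itself is kept as a factor of the dominating measure, since it has no Lebesgue
  density when \<open>S\<close> is singular.
\<close>

lemma obs_law_eq_density:
  assumes "0 < s2"
  shows "obs_law p S s2 b =
    density (mv_normal p S \<Otimes>\<^sub>M lborel) (\<lambda>z. normal_density (inner_p p (fst z) b) (sqrt s2) (snd z))"
    (is "_ = density _ ?f")
proof (rule measure_eqI)
  interpret M: prob_space "mv_normal p S" by (rule prob_space_mv_normal)
  interpret N: prob_space "centred_normal s2" by (rule prob_space_centred_normal)
  have [measurable]: "?f \<in> borel_measurable (mv_normal p S \<Otimes>\<^sub>M lborel)"
    unfolding normal_density_def by measurable
  show sets: "sets (obs_law p S s2 b) = sets (density (mv_normal p S \<Otimes>\<^sub>M lborel) ?f)"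
    unfolding sets_obs_law sets_density by (intro sets_pair_measure_cong) auto
  fix A assume obs: "A \<in> sets (obs_law p S s2 b)"
  then have A [measurable]: "A \<in> sets (vec_space p \<Otimes>\<^sub>M borel)" by simp
  then have A' [measurable]: "A \<in> sets (mv_normal p S \<Otimes>\<^sub>M lborel)" using sets by simp
  have "emeasure (obs_law p S s2 b) A =
      (\<integral>\<^sup>+w. indicator A (fst w, inner_p p (fst w) b + snd w) \<partial>(mv_normal p S \<Otimes>\<^sub>M centred_normal s2))"
    unfolding nn_integral_indicator[OF obs, symmetric]
    unfolding obs_law_def by (subst nn_integral_distr) (auto simp: case_prod_beta)
  also have "\<dots> = (\<integral>\<^sup>+x. \<integral>\<^sup>+u. indicator A (x, inner_p p x b + u) \<partial>centred_normal s2 \<partial>mv_normal p S)"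
    by (subst N.nn_integral_fst[symmetric]) auto
  also have "\<dots> = (\<integral>\<^sup>+x. \<integral>\<^sup>+y. ennreal (normal_density (inner_p p x b) (sqrt s2) y) * indicator A (x, y)
      \<partial>lborel \<partial>mv_normal p S)"
  proof (rule nn_integral_cong)
    fix x assume x: "x \<in> space (mv_normal p S)"
    have [measurable]: "(\<lambda>y. indicator A (x, y) :: ennreal) \<in> borel_measurable borel"
      using x by measurable
    have "(\<integral>\<^sup>+u. indicator A (x, inner_p p x b + u) \<partial>centred_normal s2) =
        (\<integral>\<^sup>+u. ennreal (normal_density 0 (sqrt s2) u) * indicator A (x, inner_p p x b + u) \<partial>lborel)"
      by (simp add: centred_normal_eq_density[OF assms] nn_integral_density)
    also have "\<dots> = (\<integral>\<^sup>+y. ennreal (normal_density (inner_p p x b) (sqrt s2) y) * indicator A (x, y) \<partial>lborel)"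
      by (subst (2) nn_integral_real_affine[where c = 1 and t = "inner_p p x b"])
        (auto simp: normal_density_def)
    finally show "(\<integral>\<^sup>+u. indicator A (x, inner_p p x b + u) \<partial>centred_normal s2) =
      (\<integral>\<^sup>+y. ennreal (normal_density (inner_p p x b) (sqrt s2) y) * indicator A (x, y) \<partial>lborel)" .
  qed
  also have "\<dots> = (\<integral>\<^sup>+z. ?f z * indicator A z \<partial>(mv_normal p S \<Otimes>\<^sub>M lborel))"
    by (subst lborel.nn_integral_fst[symmetric]) auto
  also have "\<dots> = emeasure (density (mv_normal p S \<Otimes>\<^sub>M lborel) ?f) A"
    by (rule emeasure_density[symmetric]) measurable
  finally show "emeasure (obs_law p S s2 b) A =
    emeasure (density (mv_normal p S \<Otimes>\<^sub>M lborel) ?f) A" .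
qed

text \<open>
  The log ratio of the conditional normal densities of \<open>y\<close> given \<open>x\<close>, with regression vectors \<open>b + g\<close>
  and \<open>b\<close>. The law of \<open>x\<close> is the same under both and cancels.
\<close>

definition obs_llr ::
    "nat \<Rightarrow> real \<Rightarrow> (nat \<Rightarrow> real) \<Rightarrow> (nat \<Rightarrow> real) \<Rightarrow> (nat \<Rightarrow> real) \<times> real \<Rightarrow> real" where
  "obs_llr p s2 b g z =
     ((snd z - inner_p p (fst z) b)\<^sup>2 - (snd z - inner_p p (fst z) (\<lambda>j. b j + g j))\<^sup>2) / (2 * s2)"

lemma measurable_obs_llr [measurable]:
  "obs_llr p s2 b g \<in> borel_measurable (vec_space p \<Otimes>\<^sub>M borel)"
  unfolding obs_llr_def[abs_def] by measurable

lemma obs_law_density_shift: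
  assumes "0 < s2"
  shows "obs_law p S s2 (\<lambda>j. b j + g j) = density (obs_law p S s2 b) (\<lambda>z. exp (obs_llr p s2 b g z))"
proof -
  have [measurable]: "(\<lambda>z. normal_density (inner_p p (fst z) b) (sqrt s2) (snd z))
      \<in> borel_measurable (mv_normal p S \<Otimes>\<^sub>M lborel)" for b
    unfolding normal_density_def by measurable
  have [measurable]: "obs_llr p s2 b g \<in> borel_measurable (mv_normal p S \<Otimes>\<^sub>M lborel)"
    unfolding obs_llr_def[abs_def] by measurable
  have "normal_density (inner_p p (fst z) b) (sqrt s2) (snd z) * exp (obs_llr p s2 b g z) =
      normal_density (inner_p p (fst z) (\<lambda>j. b j + g j)) (sqrt s2) (snd z)" for z
    using assms
    by (simp add: normal_density_def obs_llr_def diff_divide_distrib flip: exp_add)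
  then have eq: "ennreal (normal_density (inner_p p (fst z) b) (sqrt s2) (snd z)) * ennreal (exp (obs_llr p s2 b g z)) =
      ennreal (normal_density (inner_p p (fst z) (\<lambda>j. b j + g j)) (sqrt s2) (snd z))" for z
    by (subst ennreal_mult''[symmetric]) simp_all
  show ?thesis
    unfolding obs_law_eq_density[OF assms] by (subst density_density_eq) (measurable, simp only: eq)
qed

section \<open>Product densities\<close>

lemma PiM_density_iid:
  fixes I :: "'i set" and f :: "'a \<Rightarrow> ennreal"
  assumes M: "prob_space M" and D: "prob_space (density M f)" and f [measurable]: "f \<in> borel_measurable M"
    and [simp]: "finite I"
  shows "PiM I (\<lambda>_. density M f) = density (PiM I (\<lambda>_. M)) (\<lambda>w. \<Prod>i\<in>I. f (w i))"
proof (rule sym, rule product_sigma_finite.PiM_eqI)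
  show "product_sigma_finite (\<lambda>_::'i. density M f)"
    using D by (simp add: product_sigma_finite_def prob_space_imp_sigma_finite)
  interpret product_sigma_finite "\<lambda>_::'i. M"
    using M by (simp add: product_sigma_finite_def prob_space_imp_sigma_finite)
  show "sets (density (PiM I (\<lambda>_. M)) (\<lambda>w. \<Prod>i\<in>I. f (w i))) = sets (PiM I (\<lambda>_. density M f))"
    by (simp, intro sets_PiM_cong) auto
  fix A assume "\<And>i. i \<in> I \<Longrightarrow> A i \<in> sets (density M f)"
  then have A [measurable]: "\<And>i. i \<in> I \<Longrightarrow> A i \<in> sets M" by simp
  have PA: "Pi\<^sub>E I A \<in> sets (PiM I (\<lambda>_. M))"
    using A by (intro sets_PiM_I_finite) auto
  have "emeasure (density (PiM I (\<lambda>_. M)) (\<lambda>w. \<Prod>i\<in>I. f (w i))) (Pi\<^sub>E I A) =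
      (\<integral>\<^sup>+w. (\<Prod>i\<in>I. f (w i)) * indicator (Pi\<^sub>E I A) w \<partial>PiM I (\<lambda>_. M))"
    using PA by (subst emeasure_density) auto
  also have "\<dots> = (\<integral>\<^sup>+w. (\<Prod>i\<in>I. f (w i) * indicator (A i) (w i)) \<partial>PiM I (\<lambda>_. M))"
  proof (rule nn_integral_cong)
    fix w assume "w \<in> space (PiM I (\<lambda>_. M))"
    then have "w \<in> extensional I" by (auto simp: space_PiM PiE_def)
    then have "(indicator (Pi\<^sub>E I A) w :: ennreal) = (\<Prod>i\<in>I. indicator (A i) (w i))"
      by (cases "\<forall>i\<in>I. w i \<in> A i") (auto simp: PiE_def Pi_def indicator_def)
    then show "(\<Prod>i\<in>I. f (w i)) * indicator (Pi\<^sub>E I A) w = (\<Prod>i\<in>I. f (w i) * indicator (A i) (w i))"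
      by (simp add: prod.distrib)
  qed
  also have "\<dots> = (\<Prod>i\<in>I. \<integral>\<^sup>+x. f x * indicator (A i) x \<partial>M)"
    using A by (intro product_nn_integral_prod) auto
  also have "\<dots> = (\<Prod>i\<in>I. emeasure (density M f) (A i))"
    using A by (intro prod.cong refl) (simp add: emeasure_density)
  finally show "emeasure (density (PiM I (\<lambda>_. M)) (\<lambda>w. \<Prod>i\<in>I. f (w i))) (Pi\<^sub>E I A) =
      (\<Prod>i\<in>I. emeasure (density M f) (A i))" .
qed simp

section \<open>Likelihood ratio tests for arbitrary versions of the likelihoods\<close>

lemma measurable_log_lik_ratio:
  assumes [measurable]: "l1 \<in> borel_measurable M" "l0 \<in> borel_measurable M"
  shows "(\<lambda>z. log_lik_ratio (l1 z) (l0 z)) \<in> borel_measurable M"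
  unfolding log_lik_ratio_def by measurable

lemma sets_lrt_rejection:
  assumes "is_likelihood \<nu> P0 l0" "is_likelihood \<nu> P1 l1"
  shows "lrt_rejection \<nu> l1 l0 c \<in> sets \<nu>"
proof -
  have [measurable]: "(\<lambda>z. log_lik_ratio (l1 z) (l0 z)) \<in> borel_measurable \<nu>"
    using assms by (intro measurable_log_lik_ratio) (auto simp: is_likelihood_def)
  show ?thesis unfolding lrt_rejection_def by measurable
qed

text \<open>
  Likelihoods are determined only up to null sets, and the dominating measure is arbitrary. By
  uniqueness of densities \<open>l1 = l0 * exp L\<close> almost everywhere, so any version of the test rejects,
  up to null sets, when \<open>L\<close> exceeds the critical value.
\<close>

lemma lrt_rejection_exp_density:
  assumes "sigma_finite_measure \<nu>" and lik: "is_likelihood \<nu> P0 l0" "is_likelihood \<nu> P1 l1"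
    and L: "L \<in> borel_measurable P0" and P1: "P1 = density P0 (\<lambda>z. ennreal (exp (L z)))"
  shows "measure P0 (lrt_rejection \<nu> l1 l0 c) = measure P0 {z \<in> space P0. c < L z}"
    and "measure P1 (lrt_rejection \<nu> l1 l0 c) = measure P1 {z \<in> space P1. c < L z}"
proof -
  interpret sigma_finite_measure \<nu> by fact
  have l [measurable]: "l0 \<in> borel_measurable \<nu>" "l1 \<in> borel_measurable \<nu>"
    and nonneg: "\<And>z. 0 \<le> l0 z" "\<And>z. 0 \<le> l1 z"
    and D0: "P0 = density \<nu> (\<lambda>z. ennreal (l0 z))" and D1: "P1 = density \<nu> (\<lambda>z. ennreal (l1 z))"
    using lik by (auto simp: is_likelihood_def)
  have L' [measurable]: "L \<in> borel_measurable \<nu>" using L D0 by simp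
  have "density \<nu> (\<lambda>z. ennreal (l1 z)) = density \<nu> (\<lambda>z. ennreal (l0 z) * ennreal (exp (L z)))"
    using P1 unfolding D0 D1 by (subst (asm) density_density_eq) auto
  then have "AE z in \<nu>. ennreal (l1 z) = ennreal (l0 z) * ennreal (exp (L z))"
    by (intro density_unique) auto
  then have ratio: "AE z in \<nu>. l1 z = l0 z * exp (L z)"
  proof eventually_elim
    fix z assume "ennreal (l1 z) = ennreal (l0 z) * ennreal (exp (L z))"
    then have "ennreal (l1 z) = ennreal (l0 z * exp (L z))"
      using nonneg by (simp add: ennreal_mult)
    then show "l1 z = l0 z * exp (L z)" using nonneg by (subst (asm) ennreal_inj) auto
  qed
  have log: "log_lik_ratio (l0 z * exp (L z)) (l0 z) = ereal (L z)" if "0 < l0 z" for z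
    using that by (simp add: log_lik_ratio_def)
  have "AE z in P0. z \<in> lrt_rejection \<nu> l1 l0 c \<longleftrightarrow> z \<in> {z \<in> space P0. c < L z}"
    unfolding D0 AE_density[OF measurable_compose[OF l(1) measurable_ennreal]]
    using ratio by eventually_elim (auto simp: lrt_rejection_def log)
  then show "measure P0 (lrt_rejection \<nu> l1 l0 c) = measure P0 {z \<in> space P0. c < L z}"
    using sets_lrt_rejection[OF lik] by (intro measure_eq_AE) (auto simp: D0)
  have "AE z in P1. z \<in> lrt_rejection \<nu> l1 l0 c \<longleftrightarrow> z \<in> {z \<in> space P1. c < L z}"
    unfolding D1 AE_density[OF measurable_compose[OF l(2) measurable_ennreal]]
    using ratio by eventually_elim (auto simp: lrt_rejection_def log zero_less_mult_iff)
  then show "measure P1 (lrt_rejection \<nu> l1 l0 c) = measure P1 {z \<in> space P1. c < L z}"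
    using sets_lrt_rejection[OF lik] by (intro measure_eq_AE) (auto simp: D1)
qed

text \<open>
  If the hypotheses are mutually singular, the likelihood under the alternative vanishes almost
  surely under the null. The log ratio is then \<open>-\<infinity>\<close>, below every real critical value.
\<close>

lemma lrt_rejection_singular:
  assumes lik: "is_likelihood \<nu> P0 l0" "is_likelihood \<nu> P1 l1"
    and 0: "AE z in P0. Q z" and 1: "AE z in P1. \<not> Q z"
  shows "measure P0 (lrt_rejection \<nu> l1 l0 c) = 0"
proof -
  have l [measurable]: "l0 \<in> borel_measurable \<nu>" "l1 \<in> borel_measurable \<nu>"
    and nonneg: "\<And>z. 0 \<le> l1 z"
    and D0: "P0 = density \<nu> (\<lambda>z. ennreal (l0 z))" and D1: "P1 = density \<nu> (\<lambda>z. ennreal (l1 z))"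
    using lik by (auto simp: is_likelihood_def)
  have "AE z in \<nu>. 0 < l0 z \<longrightarrow> Q z" using 0 unfolding D0 by (subst (asm) AE_density) auto
  moreover have "AE z in \<nu>. 0 < l1 z \<longrightarrow> \<not> Q z" using 1 unfolding D1 by (subst (asm) AE_density) auto
  ultimately have "AE z in \<nu>. 0 < l0 z \<longrightarrow> l1 z = 0"
    by eventually_elim (use nonneg in \<open>auto simp: less_le\<close>)
  then have "AE z in P0. z \<notin> lrt_rejection \<nu> l1 l0 c"
    unfolding D0 by (subst AE_density) (auto simp: lrt_rejection_def log_lik_ratio_def elim!: eventually_mono)
  moreover have "lrt_rejection \<nu> l1 l0 c \<in> sets P0"
    using sets_lrt_rejection[OF lik] by (simp add: D0)
  ultimately have "lrt_rejection \<nu> l1 l0 c \<in> null_sets P0" by (simp add: AE_iff_null_sets)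
  then show ?thesis by (simp add: measure_def null_setsD1)
qed

section \<open>The log likelihood ratio of the data\<close>

lemma prob_space_sample_law: "prob_space (sample_law n p S s2 b)"
  unfolding sample_law_def by (intro prob_space_PiM prob_space_obs_law)

lemma distr_pair_snd_prob:
  assumes A: "prob_space A" and B: "prob_space B"
  shows "distr (A \<Otimes>\<^sub>M B) B snd = B"
proof (rule measure_eqI)
  interpret A: prob_space A by fact
  interpret B: prob_space B by fact
  fix X assume "X \<in> sets (distr (A \<Otimes>\<^sub>M B) B snd)"
  then have X: "X \<in> sets B" by simp
  then have "snd -` X \<inter> space (A \<Otimes>\<^sub>M B) = space A \<times> X"
    using sets.sets_into_space by (fastforce simp: space_pair_measure)
  then show "emeasure (distr (A \<Otimes>\<^sub>M B) B snd) X = emeasure B X"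
    using X by (simp add: emeasure_distr B.emeasure_pair_measure_Times A.emeasure_space_1)
qed simp

lemma distr_data_law_snd:
  "distr (data_law n p SA SB s2A s2B bA bB) (sample_law n p SB s2B bB) snd = sample_law n p SB s2B bB"
  unfolding data_law_def by (intro distr_pair_snd_prob prob_space_sample_law)

definition sample_llr ::
    "nat \<Rightarrow> nat \<Rightarrow> real \<Rightarrow> (nat \<Rightarrow> real) \<Rightarrow> (nat \<Rightarrow> real) \<Rightarrow> sample \<Rightarrow> real" where
  "sample_llr n p s2 b g w = (\<Sum>i<n. obs_llr p s2 b g (w i))"

lemma measurable_sample_llr [measurable]:
  "sample_llr n p s2 b g \<in> borel_measurable (sample_law n p S s2' b')"
proof -
  have [measurable]: "obs_llr p s2 b g \<in> borel_measurable (obs_law p S s2' b')"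
    using measurable_obs_llr by (simp add: measurable_cong_sets[OF sets_obs_law refl])
  show ?thesis unfolding sample_llr_def[abs_def] sample_law_def by measurable
qed

lemma sample_law_density_shift:
  assumes "0 < s2"
  shows "sample_law n p S s2 (\<lambda>j. b j + g j) =
    density (sample_law n p S s2 b) (\<lambda>w. ennreal (exp (sample_llr n p s2 b g w)))"
proof -
  have [measurable]: "obs_llr p s2 b g \<in> borel_measurable (obs_law p S s2 b)"
    using measurable_obs_llr by (simp add: measurable_cong_sets[OF sets_obs_law refl])
  have "sample_law n p S s2 (\<lambda>j. b j + g j) =
      density (sample_law n p S s2 b) (\<lambda>w. \<Prod>i<n. ennreal (exp (obs_llr p s2 b g (w i))))"
    unfolding sample_law_def obs_law_density_shift[OF assms]
    by (rule PiM_density_iid)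
      (auto simp: obs_law_density_shift[OF assms, symmetric] intro: prob_space_obs_law)
  also have "(\<lambda>w. \<Prod>i<n. ennreal (exp (obs_llr p s2 b g (w i)))) =
      (\<lambda>w. ennreal (exp (sample_llr n p s2 b g w)))"
    by (simp add: sample_llr_def exp_sum prod_ennreal)
  finally show ?thesis .
qed

lemma data_law_density_shift:
  assumes "0 < s2B"
  shows "data_law n p SA SB s2A s2B bA (\<lambda>j. bB j + g j) =
    density (data_law n p SA SB s2A s2B bA bB) (\<lambda>z. ennreal (exp (sample_llr n p s2B bB g (snd z))))"
proof -
  have sf: "sigma_finite_measure (sample_law n p S s2 b)" for S s2 b
    by (intro prob_space_imp_sigma_finite prob_space_sample_law)
  have "density (sample_law n p SA s2A bA) (\<lambda>_. 1) \<Otimes>\<^sub>M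
      density (sample_law n p SB s2B bB) (\<lambda>w. ennreal (exp (sample_llr n p s2B bB g w))) =
    density (sample_law n p SA s2A bA \<Otimes>\<^sub>M sample_law n p SB s2B bB)
      (\<lambda>(x, y). 1 * ennreal (exp (sample_llr n p s2B bB g y)))"
    using sf by (intro pair_measure_density)
      (auto simp: sample_law_density_shift[OF assms, symmetric])
  then show ?thesis
    unfolding data_law_def sample_law_density_shift[OF assms]
    by (simp add: density_1 case_prod_unfold)
qed

lemma measure_data_law_snd:
  assumes [measurable]: "X \<in> borel_measurable (sample_law n p SB s2B bB)"
  shows "measure (data_law n p SA SB s2A s2B bA bB)
      {z \<in> space (data_law n p SA SB s2A s2B bA bB). c < X (snd z)} =
    measure (sample_law n p SB s2B bB) {w \<in> space (sample_law n p SB s2B bB). (c::real) < X w}"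
proof -
  have [measurable]: "snd \<in> measurable (data_law n p SA SB s2A s2B bA bB) (sample_law n p SB s2B bB)"
    unfolding data_law_def by measurable
  have "measure (distr (data_law n p SA SB s2A s2B bA bB) (sample_law n p SB s2B bB) snd)
      {w \<in> space (sample_law n p SB s2B bB). c < X w} =
    measure (data_law n p SA SB s2A s2B bA bB)
      {z \<in> space (data_law n p SA SB s2A s2B bA bB). c < X (snd z)}"
    by (subst measure_distr)
      (auto intro!: arg_cong[where f = "measure _"] simp: data_law_def space_pair_measure)
  then show ?thesis by (simp add: distr_data_law_snd)
qed

text \<open>
  Both hypotheses are covered: \<open>b'\<close> is the regression vector of the true law, whereas the statistic is
  formed with \<open>b\<close> and \<open>g\<close>.
\<close>

lemma sample_llr_tail:
  assumes law: "distr (obs_law p S s2' b') borel (\<lambda>z. (obs_llr p s2 b g z - m) / r / sqrt n) =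
      distr std_pair borel (\<lambda>w. chaos a c w / sqrt n)"
    and "0 < r" and "1 \<le> n"
  shows "measure (sample_law n p S s2' b') {w \<in> space (sample_law n p S s2' b'). k < sample_llr n p s2 b g w} =
    1 - cdf (chaos_law n a c) ((k - n * m) / (r * sqrt n))"
proof -
  interpret C: real_distribution "chaos_law n a c" by (rule real_distribution_chaos_law)
  let ?t = "(k - n * m) / (r * sqrt n)"
  have pos: "0 < r * sqrt n" using assms(2,3) by simp
  have less: "?t < (x - n * m) / (r * sqrt n) \<longleftrightarrow> k < x" for x
    using divide_strict_right_mono[OF _ pos, of "k - n * m" "x - n * m"]
      divide_right_mono[OF _ less_imp_le[OF pos], of "x - n * m" "k - n * m"] by (auto simp: not_less[symmetric])
  have [measurable]: "obs_llr p s2 b g \<in> borel_measurable (obs_law p S s2' b')"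
    using measurable_obs_llr by (simp add: measurable_cong_sets[OF sets_obs_law refl])
  have "chaos_law n a c =
      distr (sample_law n p S s2' b') borel (\<lambda>w. \<Sum>i<n. (obs_llr p s2 b g (w i) - m) / r / sqrt n)"
    unfolding chaos_law_def sample_law_def
    by (rule iid_sum_law_cong[symmetric])
      (use law in \<open>auto intro: prob_space_obs_law prob_space_std_pair\<close>)
  also have "(\<lambda>w. \<Sum>i<n. (obs_llr p s2 b g (w i) - m) / r / sqrt n) =
      (\<lambda>w. (sample_llr n p s2 b g w - n * m) / (r * sqrt n))"
    by (simp add: sample_llr_def sum_divide_distrib[symmetric] sum_subtractf)
  finally have C: "chaos_law n a c =
      distr (sample_law n p S s2' b') borel (\<lambda>w. (sample_llr n p s2 b g w - n * m) / (r * sqrt n))" .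
  have "1 - cdf (chaos_law n a c) ?t = measure (chaos_law n a c) (space (chaos_law n a c) - {..?t})"
    unfolding cdf_def by (rule C.prob_compl[symmetric]) simp
  also have "space (chaos_law n a c) - {..?t} = {?t<..}"
    by (auto simp: chaos_law_def)
  also have "measure (chaos_law n a c) {?t<..} =
      measure (sample_law n p S s2' b') {w \<in> space (sample_law n p S s2' b'). k < sample_llr n p s2 b g w}"
    unfolding C by (subst measure_distr)
      (auto intro!: arg_cong[where f = "measure _"] simp: less simp del: divide_less_cancel)
  finally show ?thesis by simp
qed

text \<open>
  \<open>\<tau> + \<tau>\<^sup>2 / 2\<close> is the variance of one increment, and \<open>sqrt \<tau>\<close> and \<open>\<tau> / 2\<close> are its
  coefficients on the product term and on the centred square before standardisation.
\<close>

lemma chaos_coefficients: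
  assumes "0 \<le> \<tau>"
  shows "sqrt (\<tau> + \<tau>\<^sup>2 / 2) * sqrt (2 / (2 + \<tau>)) = sqrt \<tau>"
    and "sqrt (\<tau> + \<tau>\<^sup>2 / 2) * sqrt (\<tau> / (2 * (2 + \<tau>))) = \<tau> / 2"
proof -
  have "(\<tau> + \<tau>\<^sup>2 / 2) * (2 / (2 + \<tau>)) = \<tau>"
    using assms by (simp add: power2_eq_square field_simps)
  then show "sqrt (\<tau> + \<tau>\<^sup>2 / 2) * sqrt (2 / (2 + \<tau>)) = sqrt \<tau>"
    by (simp only: real_sqrt_mult[symmetric])
  have "(\<tau> + \<tau>\<^sup>2 / 2) * (\<tau> / (2 * (2 + \<tau>))) = (\<tau> / 2)\<^sup>2"
    using assms by (simp add: power2_eq_square field_simps)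
  then have "sqrt (\<tau> + \<tau>\<^sup>2 / 2) * sqrt (\<tau> / (2 * (2 + \<tau>))) = sqrt ((\<tau> / 2)\<^sup>2)"
    by (simp only: real_sqrt_mult[symmetric])
  then show "sqrt (\<tau> + \<tau>\<^sup>2 / 2) * sqrt (\<tau> / (2 * (2 + \<tau>))) = \<tau> / 2"
    using assms by simp
qed

text \<open>
  The increment is \<open>(2 u v - v\<^sup>2) / (2 s2)\<close> under the null and \<open>(2 u v + v\<^sup>2) / (2 s2)\<close> under the
  alternative, with \<open>v\<close> the signal and \<open>u\<close> the noise. The sign \<open>e\<close> treats both at once, and
  \<open>e * (\<tau> / 2)\<close> is the mean.
\<close>

lemma signal_noise_eq_chaos:
  fixes q s2 G U e :: real
  assumes "0 < s2" "0 < q"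
  defines "\<tau> \<equiv> q / s2"
  defines "v \<equiv> sqrt q * G" and "u \<equiv> sqrt s2 * U"
  shows "(2 * u * v + e * v\<^sup>2) / (2 * s2) - e * (\<tau> / 2) = sqrt (\<tau> + \<tau>\<^sup>2 / 2) *
    chaos (sqrt (2 / (2 + \<tau>))) (e * sqrt (\<tau> / (2 * (2 + \<tau>)))) (G, U)"
proof -
  have \<tau>: "0 \<le> \<tau>" using assms by (simp add: \<tau>_def)
  have s: "sqrt s2 * sqrt s2 = s2" "sqrt q * sqrt q = q" using assms by simp_all
  have "sqrt \<tau> = sqrt q * sqrt s2 / s2"
    using assms by (simp add: \<tau>_def real_sqrt_divide field_simps)
  moreover have "(2 * u * v + e * v\<^sup>2) / (2 * s2) = sqrt q * sqrt s2 / s2 * (G * U) + e * (\<tau> / 2) * G\<^sup>2"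
    unfolding u_def v_def \<tau>_def using assms by (simp add: power_mult_distrib field_simps)
  ultimately have "(2 * u * v + e * v\<^sup>2) / (2 * s2) - e * (\<tau> / 2) =
      sqrt \<tau> * (G * U) + e * (\<tau> / 2) * (G\<^sup>2 - 1)"
    by (simp only: right_diff_distrib mult_1_right)
  then show ?thesis
    unfolding chaos_def chaos_coefficients[OF \<tau>, symmetric] by (simp add: algebra_simps)
qed

lemma obs_llr_null_law:
  assumes S: "covariance_matrix p S" and "0 < s2" "0 < quad_form p S g"
  defines "\<tau> \<equiv> quad_form p S g / s2"
  shows "distr (obs_law p S s2 b) borel
      (\<lambda>z. (obs_llr p s2 b g z - - (\<tau> / 2)) / sqrt (\<tau> + \<tau>\<^sup>2 / 2) / k) =
    distr std_pair borel (\<lambda>w. chaos (sqrt (2 / (2 + \<tau>))) (- sqrt (\<tau> / (2 * (2 + \<tau>)))) w / k)"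
proof -
  define h where "h x = ((2 * snd x * fst x + (-1) * (fst x)\<^sup>2) / (2 * s2) - (-1) * (\<tau> / 2))
      / sqrt (\<tau> + \<tau>\<^sup>2 / 2) / k" for x :: "real \<times> real"
  have [measurable]: "h \<in> borel_measurable (borel \<Otimes>\<^sub>M borel)"
    unfolding h_def[abs_def] by measurable
  have r: "sqrt (\<tau> + \<tau>\<^sup>2 / 2) \<noteq> 0"
    using assms(2,3) by (simp add: \<tau>_def add_pos_pos less_imp_neq[symmetric])
  have "(obs_llr p s2 b g z - - (\<tau> / 2)) / sqrt (\<tau> + \<tau>\<^sup>2 / 2) / k =
      h (inner_p p (fst z) g, snd z - inner_p p (fst z) b)" for z
    by (simp add: h_def obs_llr_def inner_p_add power2_eq_square algebra_simps)
  moreover have "h (sqrt (quad_form p S g) * fst w, sqrt s2 * snd w) =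
      chaos (sqrt (2 / (2 + \<tau>))) (- sqrt (\<tau> / (2 * (2 + \<tau>)))) w / k" for w
    unfolding h_def fst_conv snd_conv \<tau>_def signal_noise_eq_chaos[OF assms(2,3)]
    using r by (simp add: \<tau>_def)
  ultimately show ?thesis
    using obs_law_signal_noise[OF S, of h s2 b g] by simp
qed

lemma obs_llr_alternative_law:
  assumes S: "covariance_matrix p S" and "0 < s2" "0 < quad_form p S g"
  defines "\<tau> \<equiv> quad_form p S g / s2"
  shows "distr (obs_law p S s2 (\<lambda>j. b j + g j)) borel
      (\<lambda>z. (obs_llr p s2 b g z - \<tau> / 2) / sqrt (\<tau> + \<tau>\<^sup>2 / 2) / k) =
    distr std_pair borel (\<lambda>w. chaos (sqrt (2 / (2 + \<tau>))) (sqrt (\<tau> / (2 * (2 + \<tau>)))) w / k)"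
proof -
  define h where "h x = ((2 * snd x * fst x + 1 * (fst x)\<^sup>2) / (2 * s2) - 1 * (\<tau> / 2))
      / sqrt (\<tau> + \<tau>\<^sup>2 / 2) / k" for x :: "real \<times> real"
  have [measurable]: "h \<in> borel_measurable (borel \<Otimes>\<^sub>M borel)"
    unfolding h_def[abs_def] by measurable
  have r: "sqrt (\<tau> + \<tau>\<^sup>2 / 2) \<noteq> 0"
    using assms(2,3) by (simp add: \<tau>_def add_pos_pos less_imp_neq[symmetric])
  have "(obs_llr p s2 b g z - \<tau> / 2) / sqrt (\<tau> + \<tau>\<^sup>2 / 2) / k =
      h (inner_p p (fst z) g, snd z - inner_p p (fst z) (\<lambda>j. b j + g j))" for z
    by (simp add: h_def obs_llr_def inner_p_add power2_eq_square algebra_simps)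
  moreover have "h (sqrt (quad_form p S g) * fst w, sqrt s2 * snd w) =
      chaos (sqrt (2 / (2 + \<tau>))) (sqrt (\<tau> / (2 * (2 + \<tau>)))) w / k" for w
    unfolding h_def fst_conv snd_conv \<tau>_def signal_noise_eq_chaos[OF assms(2,3)]
    using r by (simp add: \<tau>_def)
  ultimately show ?thesis
    using obs_law_signal_noise[OF S, of h s2 "\<lambda>j. b j + g j" g] by simp
qed

section \<open>Degenerate cases\<close>

text \<open>
  The normal variable \<open>x\<^sup>T g\<close> has variance \<open>0\<close>, which is possible for a nonzero \<open>g\<close> when \<open>S\<close> is
  singular.
\<close>

lemma AE_inner_p_eq_0:
  assumes "covariance_matrix p S" and "quad_form p S g = 0"
  shows "AE x in mv_normal p S. inner_p p x g = 0"
proof -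
  have eq: "(\<lambda>x. inner_p p x g) = inner_p p g" by (rule ext) (rule inner_p_commute)
  have "AE v in centred_normal 0. v = 0"
    unfolding centred_normal_def by (subst AE_distr_iff) auto
  then have "AE v in distr (mv_normal p S) borel (inner_p p g). v = 0"
    by (simp only: distr_mv_normal_inner_p[OF assms(1)] assms(2))
  then have "AE x in mv_normal p S. inner_p p g x = 0"
    by (rule AE_distrD[rotated]) (simp flip: eq)
  then show ?thesis by (simp only: eq[THEN fun_cong])
qed

lemma obs_law_shift_null:
  assumes "covariance_matrix p S" and "quad_form p S g = 0"
  shows "obs_law p S s2 (\<lambda>j. b j + g j) = obs_law p S s2 b"
proof -
  interpret M: prob_space "mv_normal p S" by (rule prob_space_mv_normal)
  interpret N: prob_space "centred_normal s2" by (rule prob_space_centred_normal)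
  have "AE x in distr (mv_normal p S \<Otimes>\<^sub>M centred_normal s2) (mv_normal p S) fst. inner_p p x g = 0"
    unfolding N.distr_pair_fst by (rule AE_inner_p_eq_0[OF assms])
  then have "AE w in mv_normal p S \<Otimes>\<^sub>M centred_normal s2. inner_p p (fst w) g = 0"
    by (rule AE_distrD[rotated]) measurable
  then show ?thesis
    unfolding obs_law_def
    by (intro distr_cong_AE) (auto simp: inner_p_add elim!: eventually_mono)
qed

lemma AE_std_pair_fst_nonzero: "AE w in std_pair. fst w \<noteq> 0"
proof -
  have "measure std_normal_distribution {0} = 0"
    using isCont_Phi[of 0] by (simp add: Phi_def std_normal.isCont_cdf)
  then have "{0} \<in> null_sets std_normal_distribution"
    by (auto simp: std_normal.emeasure_eq_measure null_sets_def)
  then have "AE x in std_normal_distribution. x \<noteq> (0::real)"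
    by (subst (asm) AE_iff_null_sets) auto
  then have "AE x in distr std_pair std_normal_distribution fst. x \<noteq> 0"
    by (simp only: std_normal.distr_pair_fst)
  then show ?thesis by (rule AE_distrD[rotated]) measurable
qed

text \<open>
  Without noise the observation lies on the graph of its own regression function, and it lies on the
  other graph only if \<open>x\<^sup>T g = 0\<close>, which has probability \<open>0\<close>.
\<close>

lemma obs_law_singular:
  assumes S: "covariance_matrix p S" and q: "0 < quad_form p S g"
  shows "AE z in obs_law p S 0 b. snd z - inner_p p (fst z) b = 0"
    and "AE z in obs_law p S 0 (\<lambda>j. b j + g j). snd z - inner_p p (fst z) b \<noteq> 0"
proof -
  have meas: "(\<lambda>z. snd z - inner_p p (fst z) b) \<in> borel_measurable (obs_law p S 0 b')" for b'
    by measurable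
  have "AE x in distr (obs_law p S 0 b) borel (\<lambda>z. snd (inner_p p (fst z) g, snd z - inner_p p (fst z) b)). x = 0"
    by (subst obs_law_signal_noise[OF S]) (auto simp: AE_distr_iff)
  then show "AE z in obs_law p S 0 b. snd z - inner_p p (fst z) b = 0"
    unfolding snd_conv by (rule AE_distrD[OF meas])
  let ?h = "\<lambda>z::real \<times> real. fst z + snd z"
  have residual: "?h (inner_p p (fst z) g, snd z - inner_p p (fst z) (\<lambda>j. b j + g j)) =
      snd z - inner_p p (fst z) b" for z
    by (simp add: inner_p_add)
  have "AE x in distr (obs_law p S 0 (\<lambda>j. b j + g j)) borel
      (\<lambda>z. ?h (inner_p p (fst z) g, snd z - inner_p p (fst z) (\<lambda>j. b j + g j))). x \<noteq> 0"
    using q AE_std_pair_fst_nonzero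
    by (subst obs_law_signal_noise[OF S]) (auto simp: AE_distr_iff)
  then show "AE z in obs_law p S 0 (\<lambda>j. b j + g j). snd z - inner_p p (fst z) b \<noteq> 0"
    unfolding residual by (rule AE_distrD[OF meas])
qed

lemma AE_data_law_obs:
  assumes "0 < n" and AE: "AE z in obs_law p SB s2B bB. Q z"
  shows "AE z in data_law n p SA SB s2A s2B bA bB. Q (snd z 0)"
proof (rule AE_distrD[where M' = "sample_law n p SB s2B bB"])
  show "snd \<in> measurable (data_law n p SA SB s2A s2B bA bB) (sample_law n p SB s2B bB)"
    unfolding data_law_def by measurable
  show "AE w in distr (data_law n p SA SB s2A s2B bA bB) (sample_law n p SB s2B bB) snd. Q (w 0)"
    unfolding distr_data_law_snd
    unfolding sample_law_def using assms by (intro AE_PiM_component prob_space_obs_law) auto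
qed

section \<open>From the limit laws to the power\<close>

text \<open>
  The size condition forces the critical value \<open>t\<close> to be close to \<open>Phi_inv (1 - \<alpha>)\<close>, because \<open>Phi\<close> is
  strictly increasing and the null distribution function is uniformly close to it. The power is then
  close to \<open>1 - Phi (t - d n) = Phi (d n - t)\<close>, and the Lipschitz bound allows \<open>t\<close> to be replaced by its
  limit whatever the size of \<open>d n\<close>. The first alternative is for those \<open>n\<close> at which the two hypotheses
  coincide.
\<close>

lemma power_limit:
  fixes M0 M1 :: "nat \<Rightarrow> real measure" and pw d :: "nat \<Rightarrow> real"
  assumes real0: "\<And>n. real_distribution (M0 n)" and real1: "\<And>n. real_distribution (M1 n)"
    and conv0: "weak_conv_m M0 std_normal_distribution"
    and conv1: "weak_conv_m M1 std_normal_distribution"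
    and \<alpha>: "0 < \<alpha>" "\<alpha> < 1"
    and pw: "\<And>n. 1 \<le> n \<Longrightarrow> pw n = Phi (d n - Phi_inv (1 - \<alpha>)) \<or>
      (\<exists>t. 1 - cdf (M0 n) t = \<alpha> \<and> pw n = 1 - cdf (M1 n) (t - d n))"
  shows "(\<lambda>n. pw n - Phi (d n - Phi_inv (1 - \<alpha>))) \<longlonglongrightarrow> 0"
proof (rule tendstoI)
  fix e :: real assume "0 < e"
  define z where "z = Phi_inv (1 - \<alpha>)"
  have z: "Phi z = 1 - \<alpha>" unfolding z_def using \<alpha> by (intro Phi_Phi_inv) auto
  define \<delta> where "\<delta> = min (e / 2) (min (Phi z - Phi (z - e / 2)) (Phi (z + e / 2) - Phi z))"
  have "0 < \<delta>" using \<open>0 < e\<close> Phi_strict_mono by (simp add: \<delta>_def)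
  have cont: "isCont (cdf std_normal_distribution) x" for x
    using isCont_Phi unfolding Phi_def .
  have "\<forall>\<^sub>F n in sequentially. \<forall>x. \<bar>cdf (M0 n) x - Phi x\<bar> < \<delta>"
      "\<forall>\<^sub>F n in sequentially. \<forall>x. \<bar>cdf (M1 n) x - Phi x\<bar> < \<delta>"
    unfolding Phi_def using real0 real1 conv0 conv1 cont \<open>0 < \<delta>\<close>
    by (intro weak_conv_m_cdf_uniform real_dist_normal_dist; simp)+
  moreover have "\<forall>\<^sub>F n in sequentially. 1 \<le> n" by (rule eventually_ge_at_top)
  ultimately show "\<forall>\<^sub>F n in sequentially. dist (pw n - Phi (d n - Phi_inv (1 - \<alpha>))) 0 < e"
  proof eventually_elim
    fix n :: nat
    assume 0: "\<forall>x. \<bar>cdf (M0 n) x - Phi x\<bar> < \<delta>" and 1: "\<forall>x. \<bar>cdf (M1 n) x - Phi x\<bar> < \<delta>"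
      and "1 \<le> n"
    from pw[OF \<open>1 \<le> n\<close>] show "dist (pw n - Phi (d n - Phi_inv (1 - \<alpha>))) 0 < e"
    proof (elim disjE exE conjE)
      fix t assume t: "1 - cdf (M0 n) t = \<alpha>" and pwn: "pw n = 1 - cdf (M1 n) (t - d n)"
      have "\<bar>Phi t - Phi z\<bar> < \<delta>" using 0[rule_format, of t] t z by (simp add: abs_minus_commute algebra_simps)
      then have "Phi (z - e / 2) < Phi t" "Phi t < Phi (z + e / 2)"
        unfolding \<delta>_def by linarith+
      then have "z - e / 2 < t" "t < z + e / 2"
        using Phi_mono by (meson not_le)+
      then have "\<bar>(d n - t) - (d n - z)\<bar> < e / 2" by (simp add: abs_if)
      then have A: "\<bar>Phi (d n - t) - Phi (d n - z)\<bar> < e / 2"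
        using Phi_lipschitz[of "d n - t" "d n - z"] by linarith
      have "Phi (d n - t) = 1 - Phi (t - d n)" using Phi_minus[of "t - d n"] by simp
      then have "\<bar>pw n - Phi (d n - t)\<bar> < e / 2"
        using 1[rule_format, of "t - d n"] pwn unfolding \<delta>_def by linarith
      with A show ?thesis unfolding z_def dist_real_def by linarith
    qed (use \<open>0 < e\<close> in simp)
  qed
qed

theorem theorem7:
  fixes p :: "nat \<Rightarrow> nat"
    and SA SB :: "nat \<Rightarrow> nat \<Rightarrow> nat \<Rightarrow> real"
    and s2A s2B :: "nat \<Rightarrow> real"
    and betaA gam :: "nat \<Rightarrow> nat \<Rightarrow> real"
    and \<alpha> :: real
    and \<nu> :: "nat \<Rightarrow> (sample \<times> sample) measure"
    and l0 l1 :: "nat \<Rightarrow> sample \<times> sample \<Rightarrow> real"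
    and c :: "nat \<Rightarrow> real"
    and P0 P1 :: "nat \<Rightarrow> (sample \<times> sample) measure"
    and R :: "nat \<Rightarrow> (sample \<times> sample) set"
    and d :: "nat \<Rightarrow> real"
  defines "P0 \<equiv> \<lambda>n. data_law n (p n) (SA n) (SB n) (s2A n) (s2B n) (betaA n) (betaA n)"
    and "P1 \<equiv> \<lambda>n. data_law n (p n) (SA n) (SB n) (s2A n) (s2B n) (betaA n)
                      (\<lambda>j. betaA n j + gam n j)"
    and "R \<equiv> \<lambda>n. lrt_rejection (\<nu> n) (l1 n) (l0 n) (c n)"
    and "d \<equiv> \<lambda>n. sqrt (real n) * quad_form (p n) (SB n) (gam n) /
                  sqrt ((quad_form (p n) (SB n) (gam n))\<^sup>2 / 2
                        + quad_form (p n) (SB n) (gam n) * s2B n)"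
  assumes "0 < \<alpha>" and "\<alpha> < 1"
    and "\<forall>n\<ge>1. covariance_matrix (p n) (SA n) \<and> covariance_matrix (p n) (SB n)"
    and "\<forall>n\<ge>1. 0 \<le> s2A n \<and> 0 \<le> s2B n"
    and "\<forall>n\<ge>1. \<exists>j<p n. gam n j \<noteq> 0"
    and "\<forall>n\<ge>1. sigma_finite_measure (\<nu> n)"
    and "\<forall>n\<ge>1. is_likelihood (\<nu> n) (P0 n) (l0 n) \<and> is_likelihood (\<nu> n) (P1 n) (l1 n)"
    and "\<forall>n\<ge>1. measure (P0 n) (R n) = \<alpha>"
  shows "(\<lambda>n. measure (P1 n) (R n) - Phi (d n - Phi_inv (1 - \<alpha>))) \<longlonglongrightarrow> 0"
proof -
  define q where "q n = quad_form (p n) (SB n) (gam n)" for n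
  \<comment> \<open>the maximum with \<open>0\<close> only matters at \<open>n = 0\<close>, where the sign of the parameters is unknown\<close>
  define \<tau> where "\<tau> n = max 0 (q n / s2B n)" for n
  define a where "a n = sqrt (2 / (2 + \<tau> n))" for n
  define e where "e n = sqrt (\<tau> n / (2 * (2 + \<tau> n)))" for n
  have \<tau>: "0 \<le> \<tau> n" for n by (simp add: \<tau>_def)
  have coeff: "(a n)\<^sup>2 + 2 * (e n)\<^sup>2 = 1" for n
  proof -
    have half: "2 * (x / (2 * y)) = x / y" for x y :: real by simp
    have "0 \<le> \<tau> n / (2 * (2 + \<tau> n))" using \<tau>[of n] by simp
    then have "2 * (e n)\<^sup>2 = \<tau> n / (2 + \<tau> n)"
      by (simp only: e_def real_sqrt_pow2 half)
    moreover have "2 + \<tau> n \<noteq> 0" "(a n)\<^sup>2 = 2 / (2 + \<tau> n)"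
      using \<tau>[of n] by (simp_all add: a_def)
    ultimately show ?thesis by (simp flip: add_divide_distrib)
  qed
  show ?thesis
  proof (rule power_limit)
    show "real_distribution (chaos_law n (a n) (- e n))" "real_distribution (chaos_law n (a n) (e n))" for n
      by (rule real_distribution_chaos_law)+
    show "weak_conv_m (\<lambda>n. chaos_law n (a n) (- e n)) std_normal_distribution"
      by (rule chaos_clt) (simp add: coeff)
    show "weak_conv_m (\<lambda>n. chaos_law n (a n) (e n)) std_normal_distribution"
      by (rule chaos_clt) (simp add: coeff)
    fix n :: nat assume n: "1 \<le> n"
    have SB: "covariance_matrix (p n) (SB n)" and s2B: "0 \<le> s2B n" and size: "measure (P0 n) (R n) = \<alpha>"
      and sf: "sigma_finite_measure (\<nu> n)"
      and lik: "is_likelihood (\<nu> n) (P0 n) (l0 n)" "is_likelihood (\<nu> n) (P1 n) (l1 n)"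
      using assms(7-) n by blast+
    have "0 \<le> q n" using SB by (simp add: covariance_matrix_def q_def)
    then consider "q n = 0" | "0 < q n" "s2B n = 0" | "0 < q n" "0 < s2B n"
      using s2B by linarith
    then show "measure (P1 n) (R n) = Phi (d n - Phi_inv (1 - \<alpha>)) \<or>
      (\<exists>t. 1 - cdf (chaos_law n (a n) (- e n)) t = \<alpha> \<and>
        measure (P1 n) (R n) = 1 - cdf (chaos_law n (a n) (e n)) (t - d n))"
    proof cases
      \<comment> \<open>the alternative coincides with the null, and \<open>d n = 0 / 0 = 0\<close> gives power \<open>\<alpha>\<close>\<close>
      case 1
      then have "P1 n = P0 n"
        using SB by (simp add: P0_def P1_def data_law_def sample_law_def obs_law_shift_null q_def)
      moreover have "d n = 0" using 1 by (simp add: d_def q_def)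
      ultimately show ?thesis
        using size \<open>0 < \<alpha>\<close> \<open>\<alpha> < 1\<close> by (simp add: Phi_minus Phi_Phi_inv)
    next
      \<comment> \<open>no test of this form has size \<open>\<alpha> > 0\<close>, so the case cannot occur\<close>
      case 2
      note sing = obs_law_singular[OF SB 2(1)[unfolded q_def], of "betaA n"]
      have "AE z in P0 n. snd (snd z 0) - inner_p (p n) (fst (snd z 0)) (betaA n) = 0"
        unfolding P0_def 2(2) using n sing(1) by (intro AE_data_law_obs) simp_all
      moreover have "AE z in P1 n. \<not> snd (snd z 0) - inner_p (p n) (fst (snd z 0)) (betaA n) = 0"
        unfolding P1_def 2(2) using n sing(2) by (intro AE_data_law_obs) simp_all
      ultimately have "measure (P0 n) (R n) = 0"
        unfolding R_def by (rule lrt_rejection_singular[OF lik])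
      with size \<open>0 < \<alpha>\<close> show ?thesis by simp
    next
      case 3
      have \<tau>n: "\<tau> n = q n / s2B n" using 3 by (simp add: \<tau>_def)
      define r where "r = sqrt (\<tau> n + (\<tau> n)\<^sup>2 / 2)"
      have r: "0 < r" using 3 by (simp add: r_def \<tau>n add_pos_pos)
      let ?L = "sample_llr n (p n) (s2B n) (betaA n) (gam n)"
      have dens: "P1 n = density (P0 n) (\<lambda>z. ennreal (exp (?L (snd z))))"
        unfolding P0_def P1_def using 3 by (rule_tac data_law_density_shift)
      have meas: "(\<lambda>z. ?L (snd z)) \<in> borel_measurable (P0 n)"
        unfolding P0_def data_law_def by measurable
      note lrt = lrt_rejection_exp_density[OF sf lik meas dens, of "c n"]
      \<comment> \<open>the critical value after standardisation under the null\<close>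
      define t where "t = (c n - n * (- (\<tau> n / 2))) / (r * sqrt n)"
      have q: "0 < quad_form (p n) (SB n) (gam n)" using 3 by (simp add: q_def)
      have "measure (P0 n) (R n) = measure (sample_law n (p n) (SB n) (s2B n) (betaA n))
          {w \<in> space (sample_law n (p n) (SB n) (s2B n) (betaA n)). c n < ?L w}"
        unfolding R_def lrt(1) unfolding P0_def by (rule measure_data_law_snd) measurable
      also have "\<dots> = 1 - cdf (chaos_law n (a n) (- e n)) t"
        unfolding t_def using obs_llr_null_law[OF SB 3(2) q] r n
        by (intro sample_llr_tail) (auto simp: a_def e_def r_def \<tau>n q_def)
      finally have "1 - cdf (chaos_law n (a n) (- e n)) t = \<alpha>" using size by simp
      moreover have "measure (P1 n) (R n) = 1 - cdf (chaos_law n (a n) (e n)) (t - d n)"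
      proof -
        have "measure (P1 n) (R n) =
            measure (sample_law n (p n) (SB n) (s2B n) (\<lambda>j. betaA n j + gam n j))
            {w \<in> space (sample_law n (p n) (SB n) (s2B n) (\<lambda>j. betaA n j + gam n j)). c n < ?L w}"
          unfolding R_def lrt(2) unfolding P1_def by (rule measure_data_law_snd) measurable
        also have "\<dots> = 1 - cdf (chaos_law n (a n) (e n)) ((c n - n * (\<tau> n / 2)) / (r * sqrt n))"
          using obs_llr_alternative_law[OF SB 3(2) q] r n
          by (intro sample_llr_tail) (auto simp: a_def e_def r_def \<tau>n q_def)
        also have "(c n - n * (\<tau> n / 2)) / (r * sqrt n) = t - n * \<tau> n / (r * sqrt n)"
          by (simp add: t_def diff_divide_distrib add_divide_distrib)
        also have "n * \<tau> n / (r * sqrt n) = (n / sqrt n) * \<tau> n / r" by simp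
        also have "n / sqrt n = sqrt n" by (rule real_div_sqrt) simp
        also have "sqrt n * \<tau> n / r = d n"
        proof -
          have "r = sqrt (((q n)\<^sup>2 / 2 + q n * s2B n) / (s2B n)\<^sup>2)"
            unfolding r_def \<tau>n using 3 by (simp add: field_simps power2_eq_square)
          then have "r = sqrt ((q n)\<^sup>2 / 2 + q n * s2B n) / s2B n"
            using 3 by (simp add: real_sqrt_divide)
          then show ?thesis using 3 by (simp add: d_def \<tau>n flip: q_def)
        qed
        finally show ?thesis .
      qed
      ultimately show ?thesis by blast
    qed
  qed (use assms in auto)
qed

end
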